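(* Let $\Omega\subset\mathbb{R}^n$ be open and $(K,\delta)$-quasi-convex, where $K\ge1$ and $\delta>0$, and suppose that $\varphi\in\Phi_{\mathrm w}(\Omega)$ satisfies (A0), (A1), (A2) and (aDec)$_q$ with $q\ge1$. Then $\varphi$ has an extension $\psi\in\Phi_{\mathrm w}(\mathbb{R}^n)$ (that is, $\psi|_\Omega=\varphi$) satisfying (A0), (A1), (A2) and (aDec)$_q$ (on $\mathbb{R}^n$).
   Context: $L^0(\Omega)$ is the set of measurable functions on $\Omega$; $|B|$ is Lebesgue measure. **Almost monotone.** For $A\subset\mathbb{R}$, $f:A\to[-\infty,\infty]$ is $L$-almost increasing if $f(s)\le Lf(t)$ whenever $s<t$, and $L$-almost decreasing if $f(t)\le Lf(s)$ whenever $s<t$. **Weak $\Phi$-functions.** $\varphi:\Omega\times[0,\infty)\to[0,\infty]$ is a weak $\Phi$-function, $\varphi\in\Phi_{\mathrm w}(\Omega)$, if: (i) for every $x\in\Omega$, $t\mapsto\varphi(x,t)$ is non-decreasing, $\lim_{t\to0^+}\varphi(x,t)=0=\varphi(x,0)$ and $\lim_{t\to\infty}\varphi(x,t)=\infty$; (ii) there is $L\ge1$ such that $t\mapsto\varphi(x,t)/t$ is $L$-almost increasing on $(0,\infty)$ for every $x\in\Omega$; (iii) for every $f\in L^0(\Omega)$, $x\mapsto\varphi(x,|f(x)|)$ is measurable. The left-inverse is $\varphi^{-1}(x,\tau):=\inf\{t\ge0:\varphi(x,t)\ge\tau\}$. A function $\psi\in\Phi_{\mathrm w}(\mathbb{R}^n)$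 is an extension of $\varphi\in\Phi_{\mathrm w}(\Omega)$ if $\psi(x,t)=\varphi(x,t)$ for all $x\in\Omega$, $t\ge0$. **Conditions** on $\varphi\in\Phi_{\mathrm w}(\Omega)$ (also used with $\Omega=\mathbb{R}^n$): - (A0): there is $\beta\in(0,1)$ with $\beta\le\varphi^{-1}(x,1)\le\beta^{-1}$ for every $x\in\Omega$. - (A1): there is $\beta\in(0,1)$ with $\beta\varphi^{-1}(x,t)\le\varphi^{-1}(y,t)$ whenever $t\in[1,1/|B|]$, for every ball $B$ with $|B|\le1$ and every $x,y\in B\cap\Omega$. - (A2): for every $s>0$ there exist $\beta\in(0,1]$ and $h\in L^1(\Omega)\cap L^\infty(\Omega)$ with $\beta\varphi^{-1}(x,t)\le\varphi^{-1}(y,t)$ for every $x,y\in\Omega$ and every $t\in[h(x)+h(y),s]$. - (aDec)$_q$: there is $L_q\ge1$ such that $t\mapsto\varphi(x,t)/t^q$ is $L_q$-almost decreasing in $(0,\infty)$ for every $x\in\Omega$. **$(K,\delta)$-quasi-convex.** $\Omega$ is $(K,\delta)$-quasi-convex if whenever $x,y\in\Omega$ satisfy $|x-y|<\delta$, there exists a rectifiable curve $\gamma$ lying in $\Omega$ and connecting $x$ and $y$ such that its length satisfies $\ell(\gamma)\le K|x-y|$. *)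

theory Defs
  imports "HOL-Analysis.Analysis"
begin

text \<open>
  A function \<open>\<phi> : \<Omega> \<times> [0,\<infinity>) \<rightarrow> [0,\<infinity>]\<close> is represented by a total function of type
  \<open>'a \<Rightarrow> real \<Rightarrow> ennreal\<close>; every notion below inspects it only at points of \<open>\<Omega>\<close> and at \<open>t \<ge> 0\<close>.
  Almost monotonicity is needed only for functions with values in \<open>[0,\<infinity>]\<close>.
\<close>

definition almost_increasing_on :: "real \<Rightarrow> real set \<Rightarrow> (real \<Rightarrow> ennreal) \<Rightarrow> bool" where
  "almost_increasing_on L A f \<longleftrightarrow> (\<forall>s\<in>A. \<forall>t\<in>A. s < t \<longrightarrow> f s \<le> ennreal L * f t)"

definition almost_decreasing_on :: "real \<Rightarrow> real set \<Rightarrow> (real \<Rightarrow> ennreal) \<Rightarrow> bool" where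
  "almost_decreasing_on L A f \<longleftrightarrow> (\<forall>s\<in>A. \<forall>t\<in>A. s < t \<longrightarrow> f t \<le> ennreal L * f s)"

definition weak_Phi :: "'a::euclidean_space set \<Rightarrow> ('a \<Rightarrow> real \<Rightarrow> ennreal) \<Rightarrow> bool" where
  "weak_Phi \<Omega> \<phi> \<longleftrightarrow>
     (\<forall>x\<in>\<Omega>. mono_on {0..} (\<phi> x) \<and> \<phi> x 0 = 0 \<and>
        (\<phi> x \<longlongrightarrow> 0) (at_right 0) \<and> (\<phi> x \<longlongrightarrow> \<infinity>) at_top) \<and>
     (\<exists>L\<ge>1. \<forall>x\<in>\<Omega>. almost_increasing_on L {0<..} (\<lambda>t. \<phi> x t / ennreal t)) \<and>
     (\<forall>f :: 'a \<Rightarrow> real. f \<in> borel_measurable (lebesgue_on \<Omega>) \<longrightarrow>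
        (\<lambda>x. \<phi> x \<bar>f x\<bar>) \<in> borel_measurable (lebesgue_on \<Omega>))"

text \<open>
  The left-inverse is only evaluated at finite \<open>\<tau>\<close>. There the set below is nonempty for every weak
  \<open>\<Phi>\<close>-function, because \<open>\<phi> x t \<rightarrow> \<infinity>\<close>, so the infimum is the usual one and is finite. For
  \<open>\<tau> \<le> 0\<close> the value is \<open>0\<close>.
\<close>

definition left_inverse :: "('a \<Rightarrow> real \<Rightarrow> ennreal) \<Rightarrow> 'a \<Rightarrow> real \<Rightarrow> real" where
  "left_inverse \<phi> x \<tau> = Inf {t. t \<ge> 0 \<and> \<phi> x t \<ge> ennreal \<tau>}"

definition cond_A0 :: "'a::euclidean_space set \<Rightarrow> ('a \<Rightarrow> real \<Rightarrow> ennreal) \<Rightarrow> bool" where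
  "cond_A0 \<Omega> \<phi> \<longleftrightarrow>
     (\<exists>\<beta>\<in>{0<..<1}. \<forall>x\<in>\<Omega>. \<beta> \<le> left_inverse \<phi> x 1 \<and> left_inverse \<phi> x 1 \<le> inverse \<beta>)"

text \<open>The balls range over all balls of the ambient space, not only over those contained in \<open>\<Omega>\<close>.\<close>

definition cond_A1 :: "'a::euclidean_space set \<Rightarrow> ('a \<Rightarrow> real \<Rightarrow> ennreal) \<Rightarrow> bool" where
  "cond_A1 \<Omega> \<phi> \<longleftrightarrow>
     (\<exists>\<beta>\<in>{0<..<1}. \<forall>z r. r > 0 \<longrightarrow> measure lebesgue (ball z r) \<le> 1 \<longrightarrow>
        (\<forall>x \<in> ball z r \<inter> \<Omega>. \<forall>y \<in> ball z r \<inter> \<Omega>. \<forall>t \<in> {1 .. 1 / measure lebesgue (ball z r)}.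
           \<beta> * left_inverse \<phi> x t \<le> left_inverse \<phi> y t))"

text \<open>
  The function \<open>h\<close> is an actual function, with the inequality required at every pair of points;
  \<open>L\<^sup>\<infinity>\<close> membership means essential boundedness.
\<close>

definition cond_A2 :: "'a::euclidean_space set \<Rightarrow> ('a \<Rightarrow> real \<Rightarrow> ennreal) \<Rightarrow> bool" where
  "cond_A2 \<Omega> \<phi> \<longleftrightarrow>
     (\<forall>s>0. \<exists>\<beta>\<in>{0<..1}. \<exists>h :: 'a \<Rightarrow> real.
        integrable (lebesgue_on \<Omega>) h \<and> (\<exists>C. AE x in lebesgue_on \<Omega>. \<bar>h x\<bar> \<le> C) \<and>
        (\<forall>x\<in>\<Omega>. \<forall>y\<in>\<Omega>. \<forall>t \<in> {h x + h y .. s}.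
           \<beta> * left_inverse \<phi> x t \<le> left_inverse \<phi> y t))"

definition cond_aDec :: "real \<Rightarrow> 'a::euclidean_space set \<Rightarrow> ('a \<Rightarrow> real \<Rightarrow> ennreal) \<Rightarrow> bool" where
  "cond_aDec q \<Omega> \<phi> \<longleftrightarrow>
     (\<exists>L\<ge>1. \<forall>x\<in>\<Omega>. almost_decreasing_on L {0<..} (\<lambda>t. \<phi> x t / ennreal (t powr q)))"

text \<open>Length of a curve parametrised on \<open>[0,1]\<close>: the supremum over all inscribed polygons.\<close>

definition curve_length :: "(real \<Rightarrow> 'a::euclidean_space) \<Rightarrow> ennreal" where
  "curve_length \<gamma> =
     (SUP ts \<in> {ts. sorted ts \<and> set ts \<subseteq> {0..1}}.
        \<Sum>i<length ts - 1. ennreal (dist (\<gamma> (ts ! i)) (\<gamma> (ts ! Suc i))))"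

definition rectifiable_path :: "(real \<Rightarrow> 'a::euclidean_space) \<Rightarrow> bool" where
  "rectifiable_path \<gamma> \<longleftrightarrow> path \<gamma> \<and> curve_length \<gamma> < \<infinity>"

definition quasi_convex :: "real \<Rightarrow> real \<Rightarrow> 'a::euclidean_space set \<Rightarrow> bool" where
  "quasi_convex K \<delta> \<Omega> \<longleftrightarrow>
     (\<forall>x\<in>\<Omega>. \<forall>y\<in>\<Omega>. dist x y < \<delta> \<longrightarrow>
        (\<exists>\<gamma>. rectifiable_path \<gamma> \<and> path_image \<gamma> \<subseteq> \<Omega> \<and> pathstart \<gamma> = x \<and> pathfinish \<gamma> = y \<and>
             curve_length \<gamma> \<le> ennreal (K * dist x y)))"

definition extends_from ::
  "('a \<Rightarrow> real \<Rightarrow> ennreal) \<Rightarrow> 'a set \<Rightarrow> ('a \<Rightarrow> real \<Rightarrow> ennreal) \<Rightarrow> bool" where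
  "extends_from \<psi> \<Omega> \<phi> \<longleftrightarrow> (\<forall>x\<in>\<Omega>. \<forall>t\<ge>0. \<psi> x t = \<phi> x t)"

end

theory Submission
  imports Defs
begin

text \<open>
  Write \<open>N\<^sub>u\<close> for the left-inverse of \<open>\<phi> u\<close>. The growth conditions turn into bounds on \<open>N\<^sub>u\<close>: raising
  the level by a factor \<open>\<lambda> \<ge> 1\<close> multiplies \<open>N\<^sub>u\<close> at most by a constant times \<open>\<lambda>\<close> and at least by a constant
  times \<open>\<lambda> powr (1 / q)\<close> (\<open>left_inverse_growth_upper\<close>, \<open>left_inverse_growth_lower\<close>). The first bound makes
  (A1) insensitive to enlarging balls by a fixed factor (\<open>A1_enlarged\<close>): lowering the level to the one
  admissible for the larger ball costs only a constant. In dimension \<open>n\<close>, the left-inverses \<open>N\<^sub>u\<close> and \<open>N\<^sub>v\<close> are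
  therefore comparable at levels between \<open>1\<close> and a constant times \<open>1 / dist u v ^ n\<close>. Condition (A2) says in
  addition that, at levels between \<open>h u\<close> and \<open>1\<close>, every \<open>N\<^sub>u\<close> is comparable with that of one limit function,
  reached along a sequence \<open>z k\<close> in \<open>\<Omega>\<close> along which \<open>h\<close> tends to its infimum, with \<open>h \<ge> 0\<close> (\<open>A2_limit_sequence\<close>).

  At a point \<open>x\<close> outside \<open>\<Omega>\<close> at distance \<open>d\<close> from \<open>\<Omega>\<close>, the left-inverse of the extension has to follow three
  regimes. Below the level \<open>1\<close> it follows the limit function, which gives
  (A2) with \<open>h\<close> extended by zero. Between the levels \<open>1\<close> and \<open>1 / d ^ n\<close> it follows
  \<open>N\<^sub>v\<close> for an almost nearest point \<open>v\<close> of \<open>\<Omega>\<close>; above that level it is linear. The last regime is needed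
  because two points much closer to each other than to \<open>\<Omega>\<close> may have different nearest points, and (A1) says
  nothing about these at such high levels. As the left-inverse of a minimum is the maximum of the left-inverses
  and conversely, the three pieces can be glued by \<open>min\<close> and \<open>max\<close>, with \<open>t\<close> and \<open>t powr q\<close>, the extreme
  admissible growths, used to separate the first regime from the second. These operations preserve the
  growth conditions with the same constants (\<open>power_growth_min\<close>, \<open>power_growth_max\<close>).

  Two difficulties remain. The choice of \<open>v\<close> must be measurable, so \<open>v\<close> is taken from a dense sequence in \<open>\<Omega>\<close>;
  and boundary points of \<open>\<Omega>\<close>, which may have positive measure, have no nearest point in \<open>\<Omega>\<close>. Therefore one takes
  better and better approximations \<open>near k x\<close>, builds an approximate extension \<open>approx k\<close> from each, and defines
  the extension as their upper limit. Comparability of the left-inverses for all large \<open>k\<close> survives the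
  upper limit up to a factor \<open>2 * C\<close>, where \<open>C\<close> is the growth constant (\<open>inverse_extension_comparison\<close>).
\<close>

section \<open>Left inverses of monotone functions\<close>

text \<open>
  Unboundedness is stated in the form that makes the infimum defining the left-inverse an infimum of a
  nonempty set at every finite level.
\<close>

definition unbounded_mono :: "(real \<Rightarrow> ennreal) \<Rightarrow> bool" where
  "unbounded_mono g \<longleftrightarrow> mono_on {0..} g \<and> (\<forall>\<sigma>::real. \<exists>t\<ge>0. ennreal \<sigma> \<le> g t)"

lemma unbounded_monoD:
  assumes "unbounded_mono g" "0 \<le> s" "s \<le> t"
  shows "g s \<le> g t"
  using assms by (auto simp: unbounded_mono_def mono_on_def)

lemma left_inverse_nonneg:
  assumes "unbounded_mono (\<phi> x)"
  shows "0 \<le> left_inverse \<phi> x \<sigma>"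
  using assms unfolding left_inverse_def unbounded_mono_def by (intro cInf_greatest) auto

lemma left_inverse_nonpos_eq:
  assumes "\<sigma> \<le> 0"
  shows "left_inverse \<phi> x \<sigma> = 0"
proof -
  have "{t. t \<ge> 0 \<and> \<phi> x t \<ge> ennreal \<sigma>} = {0..}"
    using assms by (auto simp: ennreal_neg)
  then show ?thesis by (simp add: left_inverse_def)
qed

lemma left_inverse_leI:
  assumes "0 \<le> b" "\<And>s. b < s \<Longrightarrow> ennreal \<sigma> \<le> \<phi> x s"
  shows "left_inverse \<phi> x \<sigma> \<le> b"
proof (rule dense_ge)
  fix s assume "b < s"
  then show "left_inverse \<phi> x \<sigma> \<le> s"
    unfolding left_inverse_def using assms by (intro cInf_lower bdd_belowI[of _ 0]) auto
qed

lemma le_above_left_inverse: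
  assumes "unbounded_mono (\<phi> x)" "left_inverse \<phi> x \<sigma> < s"
  shows "ennreal \<sigma> \<le> \<phi> x s"
proof -
  have "{t. t \<ge> 0 \<and> \<phi> x t \<ge> ennreal \<sigma>} \<noteq> {}"
    using assms(1) by (auto simp: unbounded_mono_def)
  from cInf_lessD[OF this] assms(2)
  obtain t where "0 \<le> t" "ennreal \<sigma> \<le> \<phi> x t" "t < s"
    unfolding left_inverse_def by blast
  then show ?thesis
    using unbounded_monoD[OF assms(1), of t s] by (meson order_trans less_imp_le)
qed

lemma left_inverse_le_iff:
  assumes "unbounded_mono (\<phi> x)" "0 \<le> b"
  shows "left_inverse \<phi> x \<sigma> \<le> b \<longleftrightarrow> (\<forall>s>b. ennreal \<sigma> \<le> \<phi> x s)"
  using left_inverse_leI[of b \<sigma> \<phi> x] le_above_left_inverse[of \<phi> x \<sigma>] assms by force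

lemma left_inverse_mono:
  assumes "unbounded_mono (\<phi> x)" "\<sigma> \<le> \<tau>"
  shows "left_inverse \<phi> x \<sigma> \<le> left_inverse \<phi> x \<tau>"
proof (rule left_inverse_leI)
  show "0 \<le> left_inverse \<phi> x \<tau>"
    using left_inverse_nonneg[of \<phi> x, OF assms(1)] .
  fix s assume "left_inverse \<phi> x \<tau> < s"
  from le_above_left_inverse[of \<phi> x, OF assms(1) this]
  show "ennreal \<sigma> \<le> \<phi> x s"
    using ennreal_leI[OF assms(2)] by (rule order_trans[rotated])
qed

lemma unbounded_mono_min:
  assumes "unbounded_mono f" "unbounded_mono g"
  shows "unbounded_mono (\<lambda>t. min (f t) (g t))"
  unfolding unbounded_mono_def
proof (intro conjI allI)
  show "mono_on {0..} (\<lambda>t. min (f t) (g t))"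
    using unbounded_monoD[OF assms(1)] unbounded_monoD[OF assms(2)] by (intro mono_onI min.mono) auto
  fix \<sigma> :: real
  obtain s where "0 \<le> s" "ennreal \<sigma> \<le> f s"
    using assms(1) by (auto simp: unbounded_mono_def)
  moreover obtain t where "0 \<le> t" "ennreal \<sigma> \<le> g t"
    using assms(2) by (auto simp: unbounded_mono_def)
  ultimately have "ennreal \<sigma> \<le> f (max s t)" "ennreal \<sigma> \<le> g (max s t)"
    using unbounded_monoD[OF assms(1), of s "max s t"] unbounded_monoD[OF assms(2), of t "max s t"]
    by (auto intro: order_trans)
  then show "\<exists>t\<ge>0. ennreal \<sigma> \<le> min (f t) (g t)"
    using \<open>0 \<le> s\<close> by (intro exI[of _ "max s t"]) auto
qed

lemma unbounded_mono_max:
  assumes "unbounded_mono f" "unbounded_mono g"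
  shows "unbounded_mono (\<lambda>t. max (f t) (g t))"
  unfolding unbounded_mono_def
proof (intro conjI allI)
  show "mono_on {0..} (\<lambda>t. max (f t) (g t))"
    using unbounded_monoD[OF assms(1)] unbounded_monoD[OF assms(2)] by (intro mono_onI max.mono) auto
  show "\<exists>t\<ge>0. ennreal \<sigma> \<le> max (f t) (g t)" for \<sigma>
    using assms(1) by (auto simp: unbounded_mono_def le_max_iff_disj)
qed

text \<open>
  A level is exceeded by the minimum exactly where it is exceeded by both functions, and both superlevel
  sets are half-lines.
\<close>

lemma left_inverse_min:
  assumes "unbounded_mono (f x)" "unbounded_mono (g x)"
  shows "left_inverse (\<lambda>x t. min (f x t) (g x t)) x \<sigma> = max (left_inverse f x \<sigma>) (left_inverse g x \<sigma>)"
    (is "left_inverse ?m x \<sigma> = _")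
proof -
  note m = unbounded_mono_min[OF assms]
  let ?a = "max (left_inverse f x \<sigma>) (left_inverse g x \<sigma>)"
  have *: "left_inverse ?m x \<sigma> \<le> b \<longleftrightarrow> ?a \<le> b" if "0 \<le> b" for b
  proof -
    have "left_inverse ?m x \<sigma> \<le> b \<longleftrightarrow> (\<forall>s>b. ennreal \<sigma> \<le> min (f x s) (g x s))"
      using left_inverse_le_iff[of ?m x b \<sigma>, OF m that] .
    also have "\<dots> \<longleftrightarrow> (\<forall>s>b. ennreal \<sigma> \<le> f x s) \<and> (\<forall>s>b. ennreal \<sigma> \<le> g x s)"
      by auto
    also have "\<dots> \<longleftrightarrow> ?a \<le> b"
      by (simp only: left_inverse_le_iff[of f, OF assms(1) that, symmetric]
          left_inverse_le_iff[of g, OF assms(2) that, symmetric] max.bounded_iff)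
    finally show ?thesis .
  qed
  have "0 \<le> ?a"
    using left_inverse_nonneg[of f, OF assms(1)] by (simp add: le_max_iff_disj)
  from *[OF this] *[of "left_inverse ?m x \<sigma>", OF left_inverse_nonneg[of ?m, OF m]]
  show ?thesis by (intro antisym) blast+
qed

text \<open>
  The superlevel set of the maximum is the union of two half-lines, hence the larger of them.
\<close>

lemma left_inverse_max:
  assumes "unbounded_mono (f x)" "unbounded_mono (g x)"
  shows "left_inverse (\<lambda>x t. max (f x t) (g x t)) x \<sigma> = min (left_inverse f x \<sigma>) (left_inverse g x \<sigma>)"
    (is "left_inverse ?m x \<sigma> = _")
proof (rule antisym)
  note m = unbounded_mono_max[OF assms]
  show "left_inverse ?m x \<sigma> \<le> min (left_inverse f x \<sigma>) (left_inverse g x \<sigma>)"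
  proof (rule min.boundedI)
    show "left_inverse ?m x \<sigma> \<le> left_inverse f x \<sigma>"
      using left_inverse_nonneg[of f, OF assms(1)] le_above_left_inverse[of f, OF assms(1)]
      by (intro left_inverse_leI) (auto simp: le_max_iff_disj)
    show "left_inverse ?m x \<sigma> \<le> left_inverse g x \<sigma>"
      using left_inverse_nonneg[of g, OF assms(2)] le_above_left_inverse[of g, OF assms(2)]
      by (intro left_inverse_leI) (auto simp: le_max_iff_disj)
  qed
  show "min (left_inverse f x \<sigma>) (left_inverse g x \<sigma>) \<le> left_inverse ?m x \<sigma>"
  proof (rule ccontr)
    assume "\<not> ?thesis"
    then obtain s where s: "left_inverse ?m x \<sigma> < s" "s < left_inverse f x \<sigma>" "s < left_inverse g x \<sigma>"
      using dense[of "left_inverse ?m x \<sigma>" "min (left_inverse f x \<sigma>) (left_inverse g x \<sigma>)"]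
      by (auto simp: not_le)
    have "0 \<le> s" using left_inverse_nonneg[of ?m, OF m, of \<sigma>] s(1) by linarith
    have "\<not> ennreal \<sigma> \<le> f x s"
    proof
      assume "ennreal \<sigma> \<le> f x s"
      then have "ennreal \<sigma> \<le> f x t" if "s < t" for t
        using unbounded_monoD[OF assms(1), of s t] \<open>0 \<le> s\<close> that by simp
      then show False
        using left_inverse_leI[of s \<sigma> f x] \<open>0 \<le> s\<close> s(2) by fastforce
    qed
    moreover have "\<not> ennreal \<sigma> \<le> g x s"
    proof
      assume "ennreal \<sigma> \<le> g x s"
      then have "ennreal \<sigma> \<le> g x t" if "s < t" for t
        using unbounded_monoD[OF assms(2), of s t] \<open>0 \<le> s\<close> that by simp
      then show False
        using left_inverse_leI[of s \<sigma> g x] \<open>0 \<le> s\<close> s(3) by fastforce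
    qed
    ultimately show False
      using le_above_left_inverse[of ?m, OF m s(1)] by (simp add: le_max_iff_disj)
  qed
qed

lemma left_inverse_cong:
  assumes "\<phi> x = \<psi> y"
  shows "left_inverse \<phi> x \<sigma> = left_inverse \<psi> y \<sigma>"
  by (simp add: left_inverse_def assms)

lemma left_inverse_eqI:
  assumes "0 \<le> b" "\<And>s. b < s \<Longrightarrow> ennreal \<sigma> \<le> \<phi> x s" "\<And>s. 0 \<le> s \<Longrightarrow> ennreal \<sigma> \<le> \<phi> x s \<Longrightarrow> b \<le> s"
  shows "left_inverse \<phi> x \<sigma> = b"
proof (rule antisym)
  show "left_inverse \<phi> x \<sigma> \<le> b" using assms by (intro left_inverse_leI) auto
  have "b + 1 \<in> {t. t \<ge> 0 \<and> \<phi> x t \<ge> ennreal \<sigma>}" using assms by auto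
  then show "b \<le> left_inverse \<phi> x \<sigma>"
    unfolding left_inverse_def using assms(3) by (intro cInf_greatest) auto
qed

lemma unbounded_mono_tendsto_top:
  assumes "unbounded_mono g"
  shows "(g \<longlongrightarrow> \<infinity>) at_top"
proof -
  have "\<forall>\<^sub>F t in at_top. a < g t" if "a < top" for a
  proof -
    obtain \<sigma> where \<sigma>: "a = ennreal \<sigma>" "0 \<le> \<sigma>"
      using \<open>a < top\<close> by (cases a) auto
    obtain t where t: "0 \<le> t" "ennreal (\<sigma> + 1) \<le> g t" using assms unfolding unbounded_mono_def by blast
    have "a < g s" if "t \<le> s" for s
    proof -
      have "a < ennreal (\<sigma> + 1)" using \<sigma> by (simp add: ennreal_less_iff)
      also have "\<dots> \<le> g t" by (fact t)
      also have "\<dots> \<le> g s" using unbounded_monoD[OF assms t(1) that] .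
      finally show ?thesis .
    qed
    then show ?thesis unfolding eventually_at_top_linorder by blast
  qed
  then show ?thesis by (intro order_tendstoI) auto
qed

lemma unbounded_monoI_tendsto:
  assumes "mono_on {0..} g" "(g \<longlongrightarrow> \<infinity>) at_top"
  shows "unbounded_mono g"
  unfolding unbounded_mono_def
proof (intro conjI allI assms)
  fix \<sigma> :: real
  have "\<forall>\<^sub>F t in at_top. ennreal \<sigma> < g t" using assms(2) by (rule order_tendstoD) simp
  then have "\<forall>\<^sub>F t in at_top. ennreal \<sigma> < g t \<and> 0 \<le> t"
    by (intro eventually_conj eventually_ge_at_top)
  then obtain t where "ennreal \<sigma> < g t" "0 \<le> t"
    using eventually_happens'[OF trivial_limit_at_top_linorder] by blast
  then show "\<exists>t\<ge>0. ennreal \<sigma> \<le> g t" by (auto intro: less_imp_le)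
qed

lemma borel_measurable_mono_ennreal:
  fixes g :: "real \<Rightarrow> ennreal"
  assumes "mono g"
  shows "g \<in> borel_measurable borel"
proof (rule borel_measurableI_le)
  fix a
  have "is_interval {x. g x \<le> a}"
    using assms unfolding is_interval_1 mono_def by (auto intro: order_trans)
  then show "{x \<in> space borel. g x \<le> a} \<in> sets borel"
    by (simp add: real_interval_borel_measurable)
qed

text \<open>
  Monotone functions are Borel measurable, and \<open>g\<close> can be changed on the negative half-line to become monotone.
\<close>

lemma unbounded_mono_comp_abs_measurable:
  assumes "unbounded_mono g"
  shows "(\<lambda>t. g \<bar>t\<bar>) \<in> borel_measurable borel"
proof -
  have "mono (\<lambda>t. g (max 0 t))"
    using unbounded_monoD[OF assms] by (auto simp: mono_def)
  then have [measurable]: "(\<lambda>t. g (max 0 t)) \<in> borel_measurable borel"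
    by (rule borel_measurable_mono_ennreal)
  have "(\<lambda>t. g (max 0 \<bar>t\<bar>)) \<in> borel_measurable borel" by measurable
  then show ?thesis by simp
qed

section \<open>Two-sided growth control\<close>

text \<open>
  The two almost-monotonicity conditions for \<open>g t / t\<close> and \<open>g t / t powr q\<close>, multiplied out so that no
  extended division remains.
\<close>

definition power_growth :: "real \<Rightarrow> real \<Rightarrow> (real \<Rightarrow> ennreal) \<Rightarrow> bool" where
  "power_growth L q g \<longleftrightarrow> (\<forall>s t. 0 < s \<longrightarrow> s < t \<longrightarrow>
     g s \<le> ennreal (L * (s / t)) * g t \<and> g t \<le> ennreal (L * (t / s) powr q) * g s)"

lemma ennreal_divide_le_iff:
  assumes "0 < s" "0 < t" "0 \<le> L"
  shows "a / ennreal s \<le> ennreal L * (b / ennreal t) \<longleftrightarrow> a \<le> ennreal (L * (s / t)) * b"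
proof -
  have "ennreal L * (b / ennreal t) = ennreal (L / t) * b"
    using assms by (simp add: divide_ennreal_def inverse_ennreal ennreal_mult mult_ac divide_inverse)
  also have "L / t = 1 / s * (L * (s / t))"
    using assms by simp
  also have "ennreal \<dots> * b = ennreal (1 / s) * (ennreal (L * (s / t)) * b)"
    using assms by (subst ennreal_mult) (auto simp: mult.assoc)
  finally have "ennreal L * (b / ennreal t) = ennreal (1 / s) * (ennreal (L * (s / t)) * b)" .
  moreover have "a / ennreal s = ennreal (1 / s) * a"
    using assms by (simp add: divide_ennreal_def inverse_ennreal mult.commute divide_inverse)
  ultimately show ?thesis
    using assms by (simp add: ennreal_mult_le_mult_iff)
qed

lemma power_growth_iff:
  assumes "1 \<le> L"
  shows "power_growth L q g \<longleftrightarrow>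
    almost_increasing_on L {0<..} (\<lambda>t. g t / ennreal t) \<and>
    almost_decreasing_on L {0<..} (\<lambda>t. g t / ennreal (t powr q))"
proof -
  have *: "g s / ennreal s \<le> ennreal L * (g t / ennreal t) \<longleftrightarrow> g s \<le> ennreal (L * (s / t)) * g t"
    "g t / ennreal (t powr q) \<le> ennreal L * (g s / ennreal (s powr q))
      \<longleftrightarrow> g t \<le> ennreal (L * (t / s) powr q) * g s" if "0 < s" "s < t" for s t
  proof -
    show "g s / ennreal s \<le> ennreal L * (g t / ennreal t) \<longleftrightarrow> g s \<le> ennreal (L * (s / t)) * g t"
      using that assms by (intro ennreal_divide_le_iff) auto
    have "g t / ennreal (t powr q) \<le> ennreal L * (g s / ennreal (s powr q))
      \<longleftrightarrow> g t \<le> ennreal (L * (t powr q / s powr q)) * g s"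
      using that assms by (intro ennreal_divide_le_iff) auto
    then show "g t / ennreal (t powr q) \<le> ennreal L * (g s / ennreal (s powr q))
      \<longleftrightarrow> g t \<le> ennreal (L * (t / s) powr q) * g s"
      using that by (simp add: powr_divide)
  qed
  show ?thesis
  proof
    assume "power_growth L q g"
    then show "almost_increasing_on L {0<..} (\<lambda>t. g t / ennreal t) \<and>
        almost_decreasing_on L {0<..} (\<lambda>t. g t / ennreal (t powr q))"
      by (simp add: power_growth_def almost_increasing_on_def almost_decreasing_on_def *)
  next
    assume "almost_increasing_on L {0<..} (\<lambda>t. g t / ennreal t) \<and>
        almost_decreasing_on L {0<..} (\<lambda>t. g t / ennreal (t powr q))"
    then show "power_growth L q g"
      by (simp add: power_growth_def almost_increasing_on_def almost_decreasing_on_def *)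
  qed
qed

lemma power_growth_min:
  assumes "power_growth L q f" "power_growth L q g"
  shows "power_growth L q (\<lambda>t. min (f t) (g t))"
proof -
  have "min a b \<le> c * min a' b'" if "a \<le> c * a'" "b \<le> c * b'" for a b c a' b' :: ennreal
    using that by (simp add: min_def[of a' b'] min.coboundedI1 min.coboundedI2)
  then show ?thesis using assms unfolding power_growth_def by simp
qed

lemma power_growth_max:
  assumes "power_growth L q f" "power_growth L q g"
  shows "power_growth L q (\<lambda>t. max (f t) (g t))"
proof -
  have "max a b \<le> c * max a' b'" if "a \<le> c * a'" "b \<le> c * b'" for a b c a' b' :: ennreal
    using that mult_left_mono[of a' "max a' b'" c] mult_left_mono[of b' "max a' b'" c]
    by (meson max.boundedI max.cobounded1 max.cobounded2 order_trans zero_le)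
  then show ?thesis using assms unfolding power_growth_def by blast
qed

lemma almost_increasing_on_mono:
  assumes "almost_increasing_on L A f" "L \<le> L'"
  shows "almost_increasing_on L' A f"
  using assms mult_right_mono[OF ennreal_leI[OF assms(2)]] unfolding almost_increasing_on_def
  by (meson order_trans zero_le)

lemma almost_decreasing_on_mono:
  assumes "almost_decreasing_on L A f" "L \<le> L'"
  shows "almost_decreasing_on L' A f"
  using assms mult_right_mono[OF ennreal_leI[OF assms(2)]] unfolding almost_decreasing_on_def
  by (meson order_trans zero_le)

text \<open>
  If \<open>g\<close> exceeds \<open>\<sigma>\<close> at \<open>s\<close>, then almost-increase of \<open>g t / t\<close> forces \<open>g\<close> to exceed \<open>\<tau>\<close> at \<open>L * (\<tau> / \<sigma>) * s\<close>.
\<close>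

lemma left_inverse_growth_upper:
  assumes "unbounded_mono (\<phi> x)" "power_growth L q (\<phi> x)" "1 \<le> L" "0 < \<sigma>" "\<sigma> \<le> \<tau>"
  shows "left_inverse \<phi> x \<tau> \<le> L * (\<tau> / \<sigma>) * left_inverse \<phi> x \<sigma>"
proof -
  define c where "c = L * (\<tau> / \<sigma>)"
  have c: "1 \<le> c"
    unfolding c_def using assms by (intro mult_ge1_I) auto
  have "left_inverse \<phi> x \<tau> \<le> c * left_inverse \<phi> x \<sigma>"
  proof (rule left_inverse_leI)
    show "0 \<le> c * left_inverse \<phi> x \<sigma>"
      using c left_inverse_nonneg[of \<phi> x \<sigma>] assms(1) by simp
    fix t assume t: "c * left_inverse \<phi> x \<sigma> < t"
    define s where "s = t / c"
    have s: "left_inverse \<phi> x \<sigma> < s" "t = c * s"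
      unfolding s_def using t c by (auto simp: field_simps)
    have s0: "0 < s" using s(1) left_inverse_nonneg[of \<phi> x \<sigma>] assms(1) by linarith
    have le: "ennreal \<sigma> \<le> \<phi> x s"
      using le_above_left_inverse[of \<phi> x \<sigma> s] assms(1) s by blast
    show "ennreal \<tau> \<le> \<phi> x t"
    proof (cases "c = 1")
      case True
      then have "\<tau> \<le> \<sigma>"
        unfolding c_def using assms mult_right_mono[of 1 L \<tau>] by (simp add: field_simps)
      then show ?thesis using le True s(2) assms(5) by simp
    next
      case False
      then have "s < t" using c s(2) s0 by simp
      then have "\<phi> x s \<le> ennreal (L * (s / t)) * \<phi> x t"
        using assms(2) s0 by (auto simp: power_growth_def)
      also have "L * (s / t) = L / c"
        using s(2) s0 by simp
      also have "L / c = \<sigma> / \<tau>"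
        using assms by (simp add: c_def)
      finally have "ennreal \<sigma> \<le> ennreal (\<sigma> / \<tau>) * \<phi> x t" using le by (rule order_trans[rotated])
      then have "ennreal (\<tau> / \<sigma>) * ennreal \<sigma> \<le> ennreal (\<tau> / \<sigma>) * (ennreal (\<sigma> / \<tau>) * \<phi> x t)"
        by (intro mult_left_mono) auto
      then show ?thesis
        using assms(4,5) by (simp add: mult.assoc[symmetric] ennreal_mult[symmetric])
    qed
  qed
  then show ?thesis by (simp add: c_def)
qed

text \<open>
  If \<open>g\<close> exceeds \<open>\<tau>\<close> at \<open>s\<close>, then almost-decrease of \<open>g t / t powr q\<close> still leaves \<open>g\<close> above \<open>\<sigma>\<close> at
  \<open>(L * \<sigma> / \<tau>) powr (1 / q) * s\<close>. The constant \<open>L powr (1 / q)\<close> is then bounded by \<open>L\<close>.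
\<close>

lemma left_inverse_growth_lower:
  assumes "unbounded_mono (\<phi> x)" "power_growth L q (\<phi> x)" "1 \<le> L" "1 \<le> q" "0 < \<sigma>" "\<sigma> \<le> \<tau>"
  shows "left_inverse \<phi> x \<sigma> \<le> L * (\<sigma> / \<tau>) powr (1 / q) * left_inverse \<phi> x \<tau>"
proof -
  define c where "c = (L * \<sigma> / \<tau>) powr (1 / q)"
  have c: "0 < c"
    unfolding c_def using assms by auto
  have "left_inverse \<phi> x \<sigma> \<le> c * left_inverse \<phi> x \<tau>"
  proof (rule left_inverse_leI)
    show "0 \<le> c * left_inverse \<phi> x \<tau>"
      using c left_inverse_nonneg[of \<phi> x \<tau>] assms(1) by simp
    fix t assume t: "c * left_inverse \<phi> x \<tau> < t"
    define s where "s = t / c"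
    have s: "left_inverse \<phi> x \<tau> < s" "t = c * s"
      unfolding s_def using t c by (auto simp: field_simps)
    have s0: "0 < s" using s(1) left_inverse_nonneg[of \<phi> x \<tau>] assms(1) by linarith
    have t0: "0 < t" using s0 s(2) c by simp
    have le: "ennreal \<tau> \<le> \<phi> x s"
      using le_above_left_inverse[of \<phi> x \<tau> s] assms(1) s by blast
    show "ennreal \<sigma> \<le> \<phi> x t"
    proof (cases "s \<le> t")
      case True
      then have "\<phi> x s \<le> \<phi> x t" using unbounded_monoD[OF assms(1)] s0 by simp
      then show ?thesis using le ennreal_leI[OF assms(6)] by (meson order_trans)
    next
      case False
      then have "\<phi> x s \<le> ennreal (L * (s / t) powr q) * \<phi> x t"
        using assms(2) t0 by (auto simp: power_growth_def)
      also have "(s / t) powr q = \<tau> / (L * \<sigma>)"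
        using s(2) s0 c assms by (simp add: c_def powr_powr powr_divide)
      finally have "ennreal \<tau> \<le> ennreal (L * (\<tau> / (L * \<sigma>))) * \<phi> x t"
        using le by (rule order_trans[rotated])
      then have "ennreal (\<sigma> / \<tau>) * ennreal \<tau> \<le> ennreal (\<sigma> / \<tau>) * (ennreal (\<tau> / \<sigma>) * \<phi> x t)"
        using assms(3) by (intro mult_left_mono) auto
      then show ?thesis
        using assms(5,6) by (simp add: mult.assoc[symmetric] ennreal_mult[symmetric])
    qed
  qed
  also have "c = L powr (1 / q) * (\<sigma> / \<tau>) powr (1 / q)"
    using assms powr_mult[of L "\<sigma> / \<tau>" "1 / q"] by (simp add: c_def)
  also have "L powr (1 / q) * (\<sigma> / \<tau>) powr (1 / q) * left_inverse \<phi> x \<tau>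
      \<le> L powr 1 * (\<sigma> / \<tau>) powr (1 / q) * left_inverse \<phi> x \<tau>"
    using assms left_inverse_nonneg[of \<phi> x \<tau>]
    by (intro mult_right_mono powr_mono) auto
  finally show ?thesis using assms by simp
qed

section \<open>Upper limits of sequences of functions\<close>

lemma Limsup_le_cmult:
  fixes f g :: "nat \<Rightarrow> ennreal"
  assumes "\<And>k. f k \<le> ennreal c * g k"
  shows "limsup f \<le> ennreal c * limsup g"
proof -
  have "limsup f \<le> limsup (\<lambda>k. ennreal c * g k)"
    using assms by (intro Limsup_mono) simp
  also have "\<dots> = ennreal c * limsup g"
    by (intro Limsup_compose_continuous_mono ennreal_continuous_on_cmult)
       (auto simp: mono_def intro: mult_left_mono continuous_on_id)
  finally show ?thesis .
qed

lemma power_growth_limsup: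
  assumes "\<And>k. power_growth L q (g k)"
  shows "power_growth L q (\<lambda>t. limsup (\<lambda>k. g k t))"
  using assms unfolding power_growth_def by (blast intro: Limsup_le_cmult)

lemma le_limsupI:
  fixes f :: "nat \<Rightarrow> ennreal"
  assumes "\<exists>\<^sub>F k in sequentially. a \<le> f k"
  shows "a \<le> limsup f"
proof (rule ccontr)
  assume "\<not> a \<le> limsup f"
  then have "\<forall>\<^sub>F k in sequentially. f k < a"
    by (intro Limsup_lessD) auto
  then have "\<forall>\<^sub>F k in sequentially. \<not> a \<le> f k"
    by (rule eventually_mono) auto
  then show False using assms by (simp add: frequently_def)
qed

lemma le_limsup_above_left_inverse:
  assumes "\<And>k. unbounded_mono (F k x)" "\<exists>\<^sub>F k in sequentially. left_inverse (F k) x \<sigma> \<le> b" "b < s"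
  shows "ennreal \<sigma> \<le> limsup (\<lambda>k. F k x s)"
proof (rule le_limsupI)
  have "ennreal \<sigma> \<le> F k x s" if "left_inverse (F k) x \<sigma> \<le> b" for k
    using le_above_left_inverse[of "F k" x \<sigma> s] assms(1)[of k] assms(3) that by simp
  with assms(2) show "\<exists>\<^sub>F k in sequentially. ennreal \<sigma> \<le> F k x s"
    by (rule frequently_elim1)
qed

text \<open>
  It suffices that the bound holds for infinitely many of the functions, because each of these exceeds the
  level to the right of the bound and the upper limit is then at least the level.
\<close>

lemma left_inverse_limsup_le:
  assumes "\<And>k. unbounded_mono (F k x)" "\<exists>\<^sub>F k in sequentially. left_inverse (F k) x \<sigma> \<le> b"
  shows "left_inverse (\<lambda>x t. limsup (\<lambda>k. F k x t)) x \<sigma> \<le> b"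
proof (rule left_inverse_leI)
  obtain k where "left_inverse (F k) x \<sigma> \<le> b"
    using frequently_ex[OF assms(2)] by blast
  then show "0 \<le> b"
    using left_inverse_nonneg[of "F k" x \<sigma>] assms(1)[of k] by linarith
qed (rule le_limsup_above_left_inverse[OF assms])

lemma unbounded_mono_limsup:
  assumes "\<And>k. unbounded_mono (F k x)"
    and "\<And>\<sigma>. \<exists>b. \<exists>\<^sub>F k in sequentially. left_inverse (F k) x \<sigma> \<le> b"
  shows "unbounded_mono (\<lambda>t. limsup (\<lambda>k. F k x t))"
  unfolding unbounded_mono_def
proof (intro conjI allI)
  show "mono_on {0..} (\<lambda>t. limsup (\<lambda>k. F k x t))"
    using unbounded_monoD[OF assms(1)] by (auto simp: mono_on_def intro!: Limsup_mono always_eventually)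
  fix \<sigma> :: real
  obtain b where b: "\<exists>\<^sub>F k in sequentially. left_inverse (F k) x \<sigma> \<le> b"
    using assms(2) by blast
  have "ennreal \<sigma> \<le> limsup (\<lambda>k. F k x (max 0 b + 1))"
    by (rule le_limsup_above_left_inverse[OF assms(1) b]) simp
  then show "\<exists>t\<ge>0. ennreal \<sigma> \<le> limsup (\<lambda>k. F k x t)"
    by (intro exI[of _ "max 0 b + 1"]) auto
qed

text \<open>
  A converse to \<open>left_inverse_limsup_le\<close>. The upper limit reaches the level \<open>\<sigma>\<close> at \<open>s\<close>, so infinitely many of the
  functions exceed \<open>\<sigma> / 2\<close> there; they need not exceed \<open>\<sigma>\<close> itself. By the growth condition, passing from \<open>s\<close> to
  \<open>2 * L * s\<close> doubles the value and so recovers the level.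
\<close>

lemma frequently_left_inverse_le:
  assumes "\<And>k. unbounded_mono (F k x)" "\<And>k. power_growth L q (F k x)" "1 \<le> L"
    and "unbounded_mono (\<lambda>t. limsup (\<lambda>k. F k x t))" "0 < \<sigma>"
    and "left_inverse (\<lambda>x t. limsup (\<lambda>k. F k x t)) x \<sigma> < s"
  shows "\<exists>\<^sub>F k in sequentially. left_inverse (F k) x \<sigma> \<le> 2 * L * s"
proof (rule ccontr)
  assume "\<not> ?thesis"
  then have ev: "\<forall>\<^sub>F k in sequentially. 2 * L * s < left_inverse (F k) x \<sigma>"
    by (simp add: frequently_def not_le)
  have s0: "0 < s"
    using assms(4,6) left_inverse_nonneg[of "\<lambda>x t. limsup (\<lambda>k. F k x t)" x \<sigma>] by linarith
  have "F k x s \<le> ennreal (\<sigma> / 2)" if k: "2 * L * s < left_inverse (F k) x \<sigma>" for k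
  proof -
    have Ls: "s < 2 * L * s" using s0 assms(3) by simp
    have "F k x s \<le> ennreal (L * (s / (2 * L * s))) * F k x (2 * L * s)"
      using assms(2)[of k] s0 Ls unfolding power_growth_def by blast
    also have "L * (s / (2 * L * s)) = 1 / 2" using s0 assms(3) by simp
    also have "F k x (2 * L * s) \<le> ennreal \<sigma>"
    proof (rule ccontr)
      assume "\<not> ?thesis"
      then have "ennreal \<sigma> \<le> F k x t" if "2 * L * s < t" for t
        using unbounded_monoD[OF assms(1)[of k], of "2 * L * s" t] that Ls s0 by auto
      then have "left_inverse (F k) x \<sigma> \<le> 2 * L * s"
        using Ls s0 by (intro left_inverse_leI) auto
      then show False using k by simp
    qed
    finally have "F k x s \<le> ennreal (1 / 2) * ennreal \<sigma>"
      by (simp add: mult_left_mono)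
    also have "\<dots> = ennreal (\<sigma> / 2)"
      using ennreal_mult[of "1 / 2" \<sigma>] assms(5) by simp
    finally show ?thesis .
  qed
  with ev have "\<forall>\<^sub>F k in sequentially. F k x s \<le> ennreal (\<sigma> / 2)"
    by (auto elim: eventually_mono)
  then have "limsup (\<lambda>k. F k x s) \<le> ennreal (\<sigma> / 2)" by (rule Limsup_bounded)
  moreover have "ennreal \<sigma> \<le> limsup (\<lambda>k. F k x s)"
    using le_above_left_inverse[of "\<lambda>x t. limsup (\<lambda>k. F k x t)" x \<sigma> s] assms(4,6) by blast
  ultimately have "ennreal \<sigma> \<le> ennreal (\<sigma> / 2)" by (rule order_trans[rotated])
  then show False using assms(5) by simp
qed

section \<open>Linear functions and powers\<close>

text \<open>
  For \<open>\<kappa> = 0\<close> the quotient is infinite at every \<open>t > 0\<close> and zero at \<open>t = 0\<close>. This convention lets the linear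
  piece of the construction drop out at boundary points.
\<close>

lemma ennreal_le_divide_iff:
  assumes "0 \<le> \<kappa>" "0 \<le> t" "0 < \<sigma>"
  shows "ennreal \<sigma> \<le> ennreal t / ennreal \<kappa> \<longleftrightarrow> 0 < t \<and> \<kappa> * \<sigma> \<le> t"
proof (cases "\<kappa> = 0")
  case True
  then show ?thesis
    using assms by (cases "t = 0") (auto simp: divide_ennreal_def ennreal_mult_top)
next
  case False
  then have "0 < \<kappa>" using assms by simp
  then show ?thesis
    using assms by (auto simp: divide_ennreal field_simps intro: mult_pos_pos less_le_trans)
qed

lemma unbounded_mono_linear:
  assumes "0 \<le> \<kappa>"
  shows "unbounded_mono (\<lambda>t. ennreal t / ennreal \<kappa>)"
  unfolding unbounded_mono_def
proof (intro conjI allI)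
  show "mono_on {0..} (\<lambda>t. ennreal t / ennreal \<kappa>)"
    by (intro mono_onI divide_right_mono_ennreal ennreal_leI)
  fix \<sigma> :: real
  have "ennreal \<sigma> \<le> ennreal (max 1 \<sigma>)" by (intro ennreal_leI) simp
  also have "\<dots> \<le> ennreal (\<kappa> * max 1 \<sigma> + 1) / ennreal \<kappa>"
    using assms by (subst ennreal_le_divide_iff) (auto simp: add_nonneg_pos)
  finally show "\<exists>t\<ge>0. ennreal \<sigma> \<le> ennreal t / ennreal \<kappa>"
    using assms by (intro exI[of _ "\<kappa> * max 1 \<sigma> + 1"]) auto
qed

lemma left_inverse_linear:
  assumes "0 \<le> \<kappa> x" "0 < \<sigma>"
  shows "left_inverse (\<lambda>x t. ennreal t / ennreal (\<kappa> x)) x \<sigma> = \<kappa> x * \<sigma>"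
proof (rule left_inverse_eqI)
  show nn: "0 \<le> \<kappa> x * \<sigma>" using assms by simp
  show "ennreal \<sigma> \<le> ennreal s / ennreal (\<kappa> x)" if "\<kappa> x * \<sigma> < s" for s
    using le_less_trans[OF nn that] assms that by (subst ennreal_le_divide_iff) auto
  show "\<kappa> x * \<sigma> \<le> s" if "0 \<le> s" "ennreal \<sigma> \<le> ennreal s / ennreal (\<kappa> x)" for s
    using assms that by (subst (asm) ennreal_le_divide_iff) auto
qed

lemma unbounded_mono_powr:
  assumes "0 < q"
  shows "unbounded_mono (\<lambda>t. ennreal (t powr q))"
  unfolding unbounded_mono_def
proof (intro conjI allI)
  show "mono_on {0..} (\<lambda>t. ennreal (t powr q))"
    using assms by (intro mono_onI ennreal_leI powr_mono2) auto
  fix \<sigma> :: real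
  show "\<exists>t\<ge>0. ennreal \<sigma> \<le> ennreal (t powr q)"
    using assms by (intro exI[of _ "max 0 \<sigma> powr (1 / q)"]) (auto simp: powr_powr intro: ennreal_leI)
qed

lemma left_inverse_powr:
  assumes "0 < q" "0 < \<sigma>"
  shows "left_inverse (\<lambda>x t. ennreal (t powr q)) x \<sigma> = \<sigma> powr (1 / q)"
proof (rule left_inverse_eqI)
  show "ennreal \<sigma> \<le> ennreal (s powr q)" if "\<sigma> powr (1 / q) < s" for s
    using powr_mono2[of q "\<sigma> powr (1 / q)" s] assms that by (intro ennreal_leI) (simp add: powr_powr)
  show "\<sigma> powr (1 / q) \<le> s" if "0 \<le> s" "ennreal \<sigma> \<le> ennreal (s powr q)" for s
    using powr_mono2[of "1 / q" \<sigma> "s powr q"] assms that by (simp add: powr_powr)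
qed simp

lemma power_growth_linear:
  assumes "1 \<le> L" "1 \<le> q"
  shows "power_growth L q (\<lambda>t. ennreal t / a)"
  unfolding power_growth_def
proof (intro allI impI conjI)
  fix s t :: real assume st: "0 < s" "s < t"
  have "s \<le> L * (s / t) * t" using assms st by simp
  then have "ennreal s * inverse a \<le> ennreal (L * (s / t) * t) * inverse a"
    by (intro mult_right_mono ennreal_leI) auto
  then show "ennreal s / a \<le> ennreal (L * (s / t)) * (ennreal t / a)"
    using assms st by (subst (asm) ennreal_mult) (auto simp: divide_ennreal_def mult.assoc)
  have "(t / s) powr 1 \<le> (t / s) powr q" using assms st by (intro powr_mono) auto
  then have "1 * (t / s) \<le> L * (t / s) powr q" using assms st by (intro mult_mono) auto
  then have "t \<le> L * (t / s) powr q * s" using st by (simp add: field_simps)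
  then have "ennreal t * inverse a \<le> ennreal (L * (t / s) powr q * s) * inverse a"
    by (intro mult_right_mono ennreal_leI) auto
  then show "ennreal t / a \<le> ennreal (L * (t / s) powr q) * (ennreal s / a)"
    using assms st by (subst (asm) ennreal_mult) (auto simp: divide_ennreal_def mult.assoc)
qed

lemma power_growth_powr:
  assumes "1 \<le> L" "1 \<le> q"
  shows "power_growth L q (\<lambda>t. ennreal (t powr q))"
  unfolding power_growth_def
proof (intro allI impI conjI)
  fix s t :: real assume st: "0 < s" "s < t"
  have "(s / t) powr q \<le> (s / t) powr 1" using assms st by (intro powr_mono') auto
  then have "1 * (s / t) powr q \<le> L * (s / t)" using assms st by (intro mult_mono) auto
  then have "(s / t) powr q * t powr q \<le> L * (s / t) * t powr q" by (intro mult_right_mono) auto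
  moreover have "(s / t) powr q * t powr q = s powr q" using st by (simp add: powr_divide)
  ultimately show "ennreal (s powr q) \<le> ennreal (L * (s / t)) * ennreal (t powr q)"
    using assms st by (subst ennreal_mult[symmetric]) (auto intro: ennreal_leI)
  have "(t / s) powr q * s powr q = t powr q" using st by (simp add: powr_divide)
  then have "t powr q \<le> L * (t / s) powr q * s powr q"
    using assms mult_right_mono[of 1 L "t powr q"] by (simp add: mult.assoc)
  then show "ennreal (t powr q) \<le> ennreal (L * (t / s) powr q) * ennreal (s powr q)"
    using assms st by (subst ennreal_mult[symmetric]) (auto intro: ennreal_leI)
qed

section \<open>Consequences of the conditions on the domain\<close>

text \<open>
  The consequences of being a weak \<open>\<Phi>\<close>-function with (A0) and (aDec) that concern one point at a time, with one
  constant \<open>C\<close> for all of them.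
\<close>

locale controlled_Phi =
  fixes \<Omega> :: "(real ^ 'n) set" and \<phi> :: "real ^ 'n \<Rightarrow> real \<Rightarrow> ennreal" and q C :: real
  assumes open_domain: "open \<Omega>"
    and q_ge_1: "1 \<le> q" and C_ge_1: "1 \<le> C"
    and phi_unbounded_mono: "\<And>u. u \<in> \<Omega> \<Longrightarrow> unbounded_mono (\<phi> u)"
    and phi_zero: "\<And>u. u \<in> \<Omega> \<Longrightarrow> \<phi> u 0 = 0"
    and phi_growth: "\<And>u. u \<in> \<Omega> \<Longrightarrow> power_growth C q (\<phi> u)"
    and phi_inverse_1: "\<And>u. u \<in> \<Omega> \<Longrightarrow> 1 \<le> C * left_inverse \<phi> u 1 \<and> left_inverse \<phi> u 1 \<le> C"
begin

lemma inverse_nonneg: "u \<in> \<Omega> \<Longrightarrow> 0 \<le> left_inverse \<phi> u \<sigma>"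
  using left_inverse_nonneg[of \<phi> u] phi_unbounded_mono by blast

lemma inverse_mono: "u \<in> \<Omega> \<Longrightarrow> \<sigma> \<le> \<tau> \<Longrightarrow> left_inverse \<phi> u \<sigma> \<le> left_inverse \<phi> u \<tau>"
  using left_inverse_mono[of \<phi> u] phi_unbounded_mono by blast

lemma inverse_upper:
  "u \<in> \<Omega> \<Longrightarrow> 0 < \<sigma> \<Longrightarrow> \<sigma> \<le> \<tau> \<Longrightarrow> left_inverse \<phi> u \<tau> \<le> C * (\<tau> / \<sigma>) * left_inverse \<phi> u \<sigma>"
  using left_inverse_growth_upper[of \<phi> u] phi_unbounded_mono phi_growth C_ge_1 by blast

lemma inverse_lower:
  "u \<in> \<Omega> \<Longrightarrow> 0 < \<sigma> \<Longrightarrow> \<sigma> \<le> \<tau> \<Longrightarrow>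
    left_inverse \<phi> u \<sigma> \<le> C * (\<sigma> / \<tau>) powr (1 / q) * left_inverse \<phi> u \<tau>"
  using left_inverse_growth_lower[of \<phi> u] phi_unbounded_mono phi_growth C_ge_1 q_ge_1 by blast

lemma inverse_le_linear:
  assumes "u \<in> \<Omega>" "1 \<le> \<sigma>"
  shows "left_inverse \<phi> u \<sigma> \<le> C\<^sup>2 * \<sigma>"
proof -
  have "left_inverse \<phi> u \<sigma> \<le> C * \<sigma> * left_inverse \<phi> u 1"
    using inverse_upper[of u 1 \<sigma>] assms by simp
  also have "\<dots> \<le> C * \<sigma> * C"
    using phi_inverse_1[OF assms(1)] assms C_ge_1 by (intro mult_left_mono) auto
  finally show ?thesis by (simp add: power2_eq_square mult_ac)
qed

lemma inverse_ge_linear: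
  assumes "u \<in> \<Omega>" "0 < \<sigma>" "\<sigma> \<le> 1"
  shows "\<sigma> \<le> C\<^sup>2 * left_inverse \<phi> u \<sigma>"
proof -
  have "\<sigma> * 1 \<le> \<sigma> * (C * left_inverse \<phi> u 1)"
    using phi_inverse_1[OF assms(1)] assms by (intro mult_left_mono) auto
  also have "\<dots> \<le> \<sigma> * (C * (C * (1 / \<sigma>) * left_inverse \<phi> u \<sigma>))"
    using inverse_upper[of u \<sigma> 1] assms C_ge_1 by (intro mult_left_mono) auto
  also have "\<dots> = C\<^sup>2 * left_inverse \<phi> u \<sigma>"
    using assms by (simp add: power2_eq_square)
  finally show ?thesis by simp
qed

lemma inverse_le_root:
  assumes "u \<in> \<Omega>" "0 < \<sigma>" "\<sigma> \<le> 1"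
  shows "left_inverse \<phi> u \<sigma> \<le> C\<^sup>2 * \<sigma> powr (1 / q)"
proof -
  have "left_inverse \<phi> u \<sigma> \<le> C * \<sigma> powr (1 / q) * left_inverse \<phi> u 1"
    using inverse_lower[of u \<sigma> 1] assms by simp
  also have "\<dots> \<le> C * \<sigma> powr (1 / q) * C"
    using phi_inverse_1[OF assms(1)] assms C_ge_1 by (intro mult_left_mono) auto
  finally show ?thesis by (simp add: power2_eq_square mult_ac)
qed

lemma inverse_ge_root:
  assumes "u \<in> \<Omega>" "1 \<le> \<sigma>"
  shows "\<sigma> powr (1 / q) \<le> C\<^sup>2 * left_inverse \<phi> u \<sigma>"
proof -
  have "\<sigma> powr (1 / q) * 1 \<le> \<sigma> powr (1 / q) * (C * left_inverse \<phi> u 1)"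
    using phi_inverse_1[OF assms(1)] assms by (intro mult_left_mono) auto
  also have "\<dots> \<le> \<sigma> powr (1 / q) * (C * (C * (1 / \<sigma>) powr (1 / q) * left_inverse \<phi> u \<sigma>))"
    using inverse_lower[of u 1 \<sigma>] assms C_ge_1 by (intro mult_left_mono) auto
  also have "\<dots> = C\<^sup>2 * left_inverse \<phi> u \<sigma>"
    using assms by (simp add: power2_eq_square powr_divide)
  finally show ?thesis by simp
qed

lemma inverse_ge_1:
  assumes "u \<in> \<Omega>" "1 \<le> \<sigma>"
  shows "1 \<le> C * left_inverse \<phi> u \<sigma>"
proof -
  have "1 \<le> C * left_inverse \<phi> u 1"
    using phi_inverse_1[OF assms(1)] by simp
  also have "\<dots> \<le> C * left_inverse \<phi> u \<sigma>"
    using inverse_mono[OF assms] C_ge_1 by (intro mult_left_mono) auto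
  finally show ?thesis .
qed

text \<open>
  At levels between \<open>1\<close> and a fixed bound, all left-inverses are comparable to a constant by (A0) and growth.
\<close>

lemma inverse_comparable_bounded_level:
  assumes "u \<in> \<Omega>" "v \<in> \<Omega>" "1 \<le> \<sigma>" "\<sigma> \<le> A"
  shows "left_inverse \<phi> u \<sigma> \<le> C ^ 3 * A * left_inverse \<phi> v \<sigma>"
proof -
  have "left_inverse \<phi> u \<sigma> \<le> C\<^sup>2 * \<sigma>"
    using inverse_le_linear assms by blast
  also have "\<dots> \<le> C\<^sup>2 * A * 1"
    using assms by (simp add: mult_left_mono)
  also have "\<dots> \<le> C\<^sup>2 * A * (C * left_inverse \<phi> v \<sigma>)"
    using inverse_ge_1[of v \<sigma>] assms by (intro mult_left_mono) auto
  finally show ?thesis by (simp add: power3_eq_cube power2_eq_square mult_ac)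
qed

lemma measure_lebesgue_ball:
  assumes "0 \<le> r"
  shows "measure lebesgue (ball (x :: real ^ 'n) r) = unit_ball_vol (real CARD('n)) * r ^ CARD('n)"
  using content_ball[OF assms, of x] by (simp add: measure_completion)

text \<open>
  The ball of radius \<open>2 * dist u v\<close> around \<open>u\<close> contains both points. If its measure is \<open>m\<close>, then (A1) applies at
  levels up to \<open>1 / m\<close>, while the level \<open>\<sigma>\<close> exceeds \<open>1 / m\<close> at most by a constant factor. The growth
  bound moves the comparison from \<open>1 / m\<close> to \<open>\<sigma>\<close>. If \<open>\<sigma>\<close> is bounded, (A0) is enough.
\<close>

lemma A1_enlarged:
  assumes "cond_A1 \<Omega> \<phi>" "1 \<le> A"
  obtains B where "1 \<le> B"
    "\<And>u v \<sigma>. u \<in> \<Omega> \<Longrightarrow> v \<in> \<Omega> \<Longrightarrow> 1 \<le> \<sigma> \<Longrightarrow> \<sigma> \<le> A \<or> \<sigma> * dist u v ^ CARD('n) \<le> A \<Longrightarrow>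
      left_inverse \<phi> u \<sigma> \<le> B * left_inverse \<phi> v \<sigma>"
proof -
  obtain \<beta> where \<beta>: "0 < \<beta>" "\<beta> < 1"
    and A1: "\<And>z r x y t. r > 0 \<Longrightarrow> measure lebesgue (ball z r) \<le> 1 \<Longrightarrow> x \<in> ball z r \<Longrightarrow> x \<in> \<Omega> \<Longrightarrow>
      y \<in> ball z r \<Longrightarrow> y \<in> \<Omega> \<Longrightarrow> 1 \<le> t \<Longrightarrow> t \<le> 1 / measure lebesgue (ball z r) \<Longrightarrow>
      \<beta> * left_inverse \<phi> x t \<le> left_inverse \<phi> y t"
    using assms(1) unfolding cond_A1_def by (force simp: Ball_def)
  define V where "V = unit_ball_vol (real CARD('n)) * 2 ^ CARD('n)"
  have V: "0 < V" by (simp add: V_def)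
  \<comment> \<open>Large enough to bound both the levels for which (A0) suffices and the product of \<open>\<sigma>\<close> with the
    measure \<open>V * dist u v ^ n\<close> of the ball used below.\<close>
  define A' where "A' = A * max 1 V"
  have A': "1 \<le> A'" "A \<le> A'" "A * V \<le> A'"
    unfolding A'_def using assms(2) mult_mono[of 1 A 1 "max 1 V"] mult_left_mono[of _ "max 1 V" A] by auto
  define B where "B = C ^ 3 * A' + C * A' / \<beta>"
  have c3: "1 \<le> C ^ 3 * A'" using mult_mono[of 1 "C ^ 3" 1 A'] C_ge_1 A' by simp
  have cb: "0 \<le> C * A' / \<beta>" using \<beta> C_ge_1 A' by simp
  show thesis
  proof (rule that)
    show "1 \<le> B" using c3 cb by (simp add: B_def)
    fix u v \<sigma>
    assume u: "u \<in> \<Omega>" and v: "v \<in> \<Omega>" and \<sigma>: "1 \<le> \<sigma>"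
      and close: "\<sigma> \<le> A \<or> \<sigma> * dist u v ^ CARD('n) \<le> A"
    note nn = inverse_nonneg[OF v, of \<sigma>]
    have B1: "C ^ 3 * A' * left_inverse \<phi> v \<sigma> \<le> B * left_inverse \<phi> v \<sigma>"
      and B2: "C * A' / \<beta> * left_inverse \<phi> v \<sigma> \<le> B * left_inverse \<phi> v \<sigma>"
      using c3 mult_nonneg_nonneg[OF cb nn] mult_nonneg_nonneg[of "C ^ 3 * A'", OF _ nn]
      by (auto simp: B_def distrib_right)
    consider "\<sigma> \<le> A'" | "u = v" | "A' < \<sigma>" "u \<noteq> v" by linarith
    then show "left_inverse \<phi> u \<sigma> \<le> B * left_inverse \<phi> v \<sigma>"
    proof cases
      case 1
      then show ?thesis
        using inverse_comparable_bounded_level[OF u v \<sigma>] B1 by (meson order_trans)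
    next
      case 2
      have "1 \<le> B" using c3 cb by (simp add: B_def)
      then show ?thesis using 2 mult_right_mono[of 1 B "left_inverse \<phi> v \<sigma>"] nn by simp
    next
      case 3
      define \<rho> where "\<rho> = dist u v"
      have \<rho>: "0 < \<rho>" using 3 by (simp add: \<rho>_def)
      define m where "m = V * \<rho> ^ CARD('n)"
      have m: "0 < m" using V \<rho> by (simp add: m_def)
      have ball: "measure lebesgue (ball u (2 * \<rho>)) = m"
        using \<rho> measure_lebesgue_ball[of "2 * \<rho>" u] by (simp add: m_def V_def power_mult_distrib)
      have \<sigma>m: "\<sigma> * m \<le> A'"
      proof -
        have "\<sigma> * \<rho> ^ CARD('n) \<le> A" using close 3 A' by (auto simp: \<rho>_def)
        then have "V * (\<sigma> * \<rho> ^ CARD('n)) \<le> V * A" using V by (intro mult_left_mono) auto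
        then show ?thesis using A'(3) by (simp add: m_def mult_ac)
      qed
      have m1: "m \<le> 1"
      proof (rule ccontr)
        assume "\<not> m \<le> 1"
        then have "\<sigma> * 1 \<le> \<sigma> * m" using \<sigma> by (intro mult_left_mono) auto
        then show False using \<sigma>m 3 by simp
      qed
      define \<tau> where "\<tau> = min \<sigma> (1 / m)"
      have \<tau>: "1 \<le> \<tau>" "\<tau> \<le> \<sigma>" "\<tau> \<le> 1 / m" using \<sigma> m m1 by (auto simp: \<tau>_def)
      have "\<sigma> / \<tau> \<le> A'"
        using \<sigma> \<sigma>m m A' by (auto simp: \<tau>_def min_def)
      have "left_inverse \<phi> u \<sigma> \<le> C * (\<sigma> / \<tau>) * left_inverse \<phi> u \<tau>"
        using inverse_upper[of u \<tau> \<sigma>] u \<tau> by simp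
      also have "\<dots> \<le> C * A' * left_inverse \<phi> u \<tau>"
        using \<open>\<sigma> / \<tau> \<le> A'\<close> C_ge_1 inverse_nonneg[OF u] by (intro mult_right_mono mult_left_mono) auto
      also have "left_inverse \<phi> u \<tau> \<le> left_inverse \<phi> v \<tau> / \<beta>"
        using A1[of "2 * \<rho>" u u v \<tau>] \<rho> m1 u v \<tau> \<beta>
        unfolding ball by (simp add: \<rho>_def pos_le_divide_eq mult.commute)
      also have "left_inverse \<phi> v \<tau> \<le> left_inverse \<phi> v \<sigma>"
        by (rule inverse_mono[OF v \<tau>(2)])
      finally have "left_inverse \<phi> u \<sigma> \<le> C * A' / \<beta> * left_inverse \<phi> v \<sigma>"
        using C_ge_1 A' \<beta> by (simp add: divide_right_mono mult_left_mono)
      then show ?thesis using B2 by simp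
    qed
  qed
qed

text \<open>
  Along \<open>z\<close> the functions \<open>\<phi> (z k)\<close> play the role of a limit function at infinity: at levels between \<open>h u\<close> and \<open>1\<close>
  each \<open>\<phi> u\<close> is comparable with \<open>\<phi> (z k)\<close> for all large \<open>k\<close>.
\<close>

definition limit_sequence :: "real \<Rightarrow> (real ^ 'n \<Rightarrow> real) \<Rightarrow> (nat \<Rightarrow> real ^ 'n) \<Rightarrow> bool" where
  "limit_sequence B h z \<longleftrightarrow> (\<forall>u\<in>\<Omega>. \<forall>\<sigma>. 0 < \<sigma> \<longrightarrow> \<sigma> \<le> 1 \<longrightarrow> h u \<le> \<sigma> \<longrightarrow> (\<forall>\<^sub>F k in sequentially.
     left_inverse \<phi> u \<sigma> \<le> B * left_inverse \<phi> (z k) \<sigma> \<and> left_inverse \<phi> (z k) \<sigma> \<le> B * left_inverse \<phi> u \<sigma>))"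

text \<open>
  Choose \<open>z k\<close> such that \<open>\<bar>h (z k)\<bar>\<close> tends to the infimum \<open>m\<close> of \<open>\<bar>h\<bar>\<close>, where \<open>h\<close> is given by (A2) for \<open>s = 1\<close>. If
  \<open>m = 0\<close>, then (A2) applies to \<open>u\<close> and \<open>z k\<close> for large \<open>k\<close>, provided the level is at least \<open>2 * \<bar>h u\<bar>\<close>. If
  \<open>m > 0\<close>, then \<open>\<bar>h\<bar> / m\<close> is integrable and at least \<open>1\<close>, which leaves only the level \<open>1\<close>, covered by (A0).
\<close>

lemma A2_limit_sequence:
  assumes "cond_A2 \<Omega> \<phi>" "\<Omega> \<noteq> {}"
  obtains B h z where "1 \<le> B" "\<forall>x. 0 \<le> h x"
    "integrable (lebesgue_on \<Omega>) h" "\<exists>c. AE x in lebesgue_on \<Omega>. \<bar>h x\<bar> \<le> c"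
    "range z \<subseteq> \<Omega>" "limit_sequence B h z"
proof -
  obtain \<beta> h\<^sub>0 c where \<beta>: "0 < \<beta>" "\<beta> \<le> 1" and h\<^sub>0: "integrable (lebesgue_on \<Omega>) h\<^sub>0"
    and c: "AE x in lebesgue_on \<Omega>. \<bar>h\<^sub>0 x\<bar> \<le> c"
    and A2: "\<And>x y t. x \<in> \<Omega> \<Longrightarrow> y \<in> \<Omega> \<Longrightarrow> h\<^sub>0 x + h\<^sub>0 y \<le> t \<Longrightarrow> t \<le> 1 \<Longrightarrow>
      \<beta> * left_inverse \<phi> x t \<le> left_inverse \<phi> y t"
    using assms(1)[unfolded cond_A2_def, rule_format, of 1] by (auto simp: Ball_def)
  define m where "m = (INF x\<in>\<Omega>. \<bar>h\<^sub>0 x\<bar>)"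
  have bdd: "bdd_below ((\<lambda>x. \<bar>h\<^sub>0 x\<bar>) ` \<Omega>)" by (auto intro: bdd_belowI[of _ 0])
  have m0: "0 \<le> m" unfolding m_def using assms(2) by (intro cINF_greatest) auto
  have m_le: "m \<le> \<bar>h\<^sub>0 x\<bar>" if "x \<in> \<Omega>" for x
    unfolding m_def using bdd that by (rule cINF_lower)
  have "\<exists>z\<in>\<Omega>. \<bar>h\<^sub>0 z\<bar> < m + inverse (real (Suc k))" for k
    using cINF_less_iff[OF assms(2) bdd, of "m + inverse (real (Suc k))"] by (simp add: m_def)
  \<comment> \<open>The infimum need not be attained, so a minimising sequence takes the place of a point.\<close>
  then obtain z where z: "\<And>k. z k \<in> \<Omega>" "\<And>k. \<bar>h\<^sub>0 (z k)\<bar> < m + inverse (real (Suc k))"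
    by metis
  define B where "B = 1 / \<beta> + C ^ 3"
  have C3: "1 \<le> C ^ 3" using C_ge_1 by simp
  have B: "1 \<le> B" "1 / \<beta> \<le> B" "C ^ 3 \<le> B"
    using \<beta> C3 zero_less_divide_1_iff[of \<beta>] unfolding B_def by linarith+
  show thesis
  proof (cases "m = 0")
    case True
    show thesis
    proof (rule that[of B "\<lambda>x. 2 * \<bar>h\<^sub>0 x\<bar>" z])
      show "integrable (lebesgue_on \<Omega>) (\<lambda>x. 2 * \<bar>h\<^sub>0 x\<bar>)"
        using h\<^sub>0 by simp
      have "AE x in lebesgue_on \<Omega>. \<bar>2 * \<bar>h\<^sub>0 x\<bar>\<bar> \<le> 2 * c"
        using c by eventually_elim simp
      then show "\<exists>c. AE x in lebesgue_on \<Omega>. \<bar>2 * \<bar>h\<^sub>0 x\<bar>\<bar> \<le> c" by blast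
      show "limit_sequence B (\<lambda>x. 2 * \<bar>h\<^sub>0 x\<bar>) z"
        unfolding limit_sequence_def
      proof (intro ballI allI impI)
      fix u \<sigma> assume u: "u \<in> \<Omega>" and \<sigma>: "0 < \<sigma>" "\<sigma> \<le> 1" "2 * \<bar>h\<^sub>0 u\<bar> \<le> \<sigma>"
      have "(\<lambda>k. inverse (real (Suc k))) \<longlonglongrightarrow> 0" by (rule LIMSEQ_inverse_real_of_nat)
      then have "\<forall>\<^sub>F k in sequentially. inverse (real (Suc k)) < \<sigma> / 2"
        using \<sigma> by (intro order_tendstoD(2)) auto
      then show "\<forall>\<^sub>F k in sequentially. left_inverse \<phi> u \<sigma> \<le> B * left_inverse \<phi> (z k) \<sigma> \<and>
          left_inverse \<phi> (z k) \<sigma> \<le> B * left_inverse \<phi> u \<sigma>"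
      proof eventually_elim
        case (elim k)
        then have "h\<^sub>0 u + h\<^sub>0 (z k) \<le> \<sigma>" using z(2)[of k] \<sigma> True by linarith
        then have "\<beta> * left_inverse \<phi> u \<sigma> \<le> left_inverse \<phi> (z k) \<sigma>"
          "\<beta> * left_inverse \<phi> (z k) \<sigma> \<le> left_inverse \<phi> u \<sigma>"
          using A2[of u "z k" \<sigma>] A2[of "z k" u \<sigma>] u z(1)[of k] \<sigma> by (auto simp: add.commute)
        then have "left_inverse \<phi> u \<sigma> \<le> 1 / \<beta> * left_inverse \<phi> (z k) \<sigma>"
          "left_inverse \<phi> (z k) \<sigma> \<le> 1 / \<beta> * left_inverse \<phi> u \<sigma>"
          using \<beta> by (auto simp: field_simps)
        then show ?case
          using mult_right_mono[OF B(2) inverse_nonneg[OF u, of \<sigma>]]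
            mult_right_mono[OF B(2) inverse_nonneg[OF z(1), of k \<sigma>]] by linarith
      qed
      qed
    qed (use B z in auto)
  next
    case False
    then have m: "0 < m" using m0 by simp
    show thesis
    proof (rule that[of B "\<lambda>x. \<bar>h\<^sub>0 x\<bar> / m" z])
      show "integrable (lebesgue_on \<Omega>) (\<lambda>x. \<bar>h\<^sub>0 x\<bar> / m)"
        using h\<^sub>0 by simp
      have "AE x in lebesgue_on \<Omega>. \<bar>\<bar>h\<^sub>0 x\<bar> / m\<bar> \<le> c / m"
        using c by eventually_elim (use m in \<open>simp add: divide_right_mono\<close>)
      then show "\<exists>c. AE x in lebesgue_on \<Omega>. \<bar>\<bar>h\<^sub>0 x\<bar> / m\<bar> \<le> c" by blast
      show "limit_sequence B (\<lambda>x. \<bar>h\<^sub>0 x\<bar> / m) z"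
        unfolding limit_sequence_def
      proof (intro ballI allI impI)
      fix u \<sigma> assume u: "u \<in> \<Omega>" and \<sigma>: "0 < \<sigma>" "\<sigma> \<le> 1" "\<bar>h\<^sub>0 u\<bar> / m \<le> \<sigma>"
      have "1 \<le> \<bar>h\<^sub>0 u\<bar> / m" using m_le[OF u] m by simp
      then have \<sigma>1: "\<sigma> = 1" using \<sigma> by simp
      have "left_inverse \<phi> u \<sigma> \<le> B * left_inverse \<phi> (z k) \<sigma> \<and>
          left_inverse \<phi> (z k) \<sigma> \<le> B * left_inverse \<phi> u \<sigma>" for k
        using inverse_comparable_bounded_level[OF u z(1), of \<sigma> 1 k]
          inverse_comparable_bounded_level[OF z(1) u, of \<sigma> 1 k] \<sigma>1
          mult_right_mono[OF B(3) inverse_nonneg[OF u, of \<sigma>]]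
          mult_right_mono[OF B(3) inverse_nonneg[OF z(1), of k \<sigma>]] by simp
      then show "\<forall>\<^sub>F k in sequentially. left_inverse \<phi> u \<sigma> \<le> B * left_inverse \<phi> (z k) \<sigma> \<and>
          left_inverse \<phi> (z k) \<sigma> \<le> B * left_inverse \<phi> u \<sigma>" by simp
      qed
    qed (use B z m in auto)
  qed
qed

end

section \<open>The extension\<close>

lemma power_add_le:
  fixes a b :: real
  assumes "0 \<le> a" "0 \<le> b"
  shows "(a + b) ^ n \<le> 2 ^ n * (a ^ n + b ^ n)"
proof -
  have "(a + b) ^ n \<le> (2 * max a b) ^ n" using assms by (intro power_mono) auto
  also have "\<dots> = 2 ^ n * max a b ^ n" by (rule power_mult_distrib)
  also have "max a b ^ n \<le> a ^ n + b ^ n" using assms by (simp add: max_def)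
  finally show ?thesis by simp
qed

text \<open>
  The data of the construction: a dense sequence \<open>e\<close> in the domain, from which almost nearest points are
  chosen measurably, and a sequence \<open>z\<close>, which supplies the behaviour at infinity.
\<close>

locale Phi_extension = controlled_Phi \<Omega> \<phi> q C
  for \<Omega> :: "(real ^ 'n) set" and \<phi> q C +
  fixes e z :: "nat \<Rightarrow> real ^ 'n"
  assumes e_in: "\<And>i. e i \<in> \<Omega>" and e_dense: "\<Omega> \<subseteq> closure (range e)"
    and z_in: "\<And>k. z k \<in> \<Omega>"
    and phi_tendsto_0: "\<And>u. u \<in> \<Omega> \<Longrightarrow> (\<phi> u \<longlongrightarrow> 0) (at_right 0)"
    and phi_measurable: "\<And>f. f \<in> borel_measurable (lebesgue_on \<Omega>) \<Longrightarrow>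
      (\<lambda>x. \<phi> x \<bar>f x\<bar>) \<in> borel_measurable (lebesgue_on \<Omega>)"
begin

text \<open>
  Taking the first suitable index makes the choice a measurable function of \<open>x\<close> with countably many values.
\<close>

definition near_index :: "nat \<Rightarrow> real ^ 'n \<Rightarrow> nat" where
  "near_index k x = (LEAST i. dist x (e i) < infdist x \<Omega> + inverse (real (Suc k)))"

definition near :: "nat \<Rightarrow> real ^ 'n \<Rightarrow> real ^ 'n" where
  "near k x = (if x \<in> \<Omega> then x else e (near_index k x))"

text \<open>
  The reciprocal of the level at which the linear regime starts. It is \<open>0\<close> on the closure of \<open>\<Omega>\<close>, where that
  level is infinite. The cap at \<open>1\<close> keeps the level at least \<open>1\<close>.
\<close>

definition inv_level :: "real ^ 'n \<Rightarrow> real" where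
  "inv_level x = min 1 (infdist x \<Omega> ^ CARD('n))"

text \<open>
  Chosen such that the line \<open>t / inv_slope k x\<close> attains the level \<open>1 / inv_level x\<close> exactly at the value of the left-inverse of
  \<open>\<phi> (near k x)\<close> there.
\<close>

definition inv_slope :: "nat \<Rightarrow> real ^ 'n \<Rightarrow> real" where
  "inv_slope k x = inv_level x * left_inverse \<phi> (near k x) (1 / inv_level x)"

text \<open>
  The second argument of \<open>max\<close> describes the levels above \<open>1\<close>, where \<open>t\<close> in the first argument is
  dominated by it up to a constant factor; the power \<open>t powr q\<close> keeps the second argument small at levels
  below \<open>1\<close>, where \<open>\<phi> (z k)\<close> prevails.
\<close>

definition approx :: "nat \<Rightarrow> real ^ 'n \<Rightarrow> real \<Rightarrow> ennreal" where
  "approx k x t = (if x \<in> \<Omega> then \<phi> x t else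
     max (min (\<phi> (z k) t) (ennreal t))
       (min (min (\<phi> (near k x) t) (ennreal (t powr q))) (ennreal t / ennreal (inv_slope k x))))"

definition extension :: "real ^ 'n \<Rightarrow> real \<Rightarrow> ennreal" where
  "extension x t = limsup (\<lambda>k. approx k x t)"

lemma near_index_close: "dist x (e (near_index k x)) < infdist x \<Omega> + inverse (real (Suc k))"
proof -
  have "infdist x (range e) \<le> infdist x \<Omega>"
    using infdist_mono[OF e_dense, of x] e_in by (simp add: infdist_eq_setdist) (metis empty_iff)
  then have "infdist x (range e) < infdist x \<Omega> + inverse (real (Suc k))"
    by (rule le_less_trans) simp
  then have "(INF i. dist x (e i)) < infdist x \<Omega> + inverse (real (Suc k))"
    by (simp add: infdist_def image_image)
  then have "\<exists>i. dist x (e i) < infdist x \<Omega> + inverse (real (Suc k))"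
    by (subst (asm) cINF_less_iff) (auto intro: bdd_belowI[of _ 0])
  then show ?thesis unfolding near_index_def by (rule LeastI_ex)
qed

lemma near_in: "near k x \<in> \<Omega>"
  using e_in by (simp add: near_def)

lemma dist_near: "dist x (near k x) \<le> infdist x \<Omega> + inverse (real (Suc k))"
  using near_index_close[of x k] by (auto simp: near_def infdist_nonneg intro: add_nonneg_nonneg)

lemma inv_level_bounds: "0 \<le> inv_level x" "inv_level x \<le> 1"
  by (auto simp: inv_level_def infdist_nonneg)

lemma inv_level_domain: "x \<in> \<Omega> \<Longrightarrow> inv_level x = 0"
  by (simp add: inv_level_def power_0_left)

lemma inv_slope_nonneg: "0 \<le> inv_slope k x"
  using inv_level_bounds inverse_nonneg[OF near_in] by (simp add: inv_slope_def)

lemma approx_outside: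
  assumes "x \<notin> \<Omega>"
  shows "approx k x = (\<lambda>t. max (min (\<phi> (z k) t) (ennreal t))
       (min (min (\<phi> (near k x) t) (ennreal (t powr q))) (ennreal t / ennreal (inv_slope k x))))"
  using assms by (simp add: approx_def fun_eq_iff)

lemma unbounded_mono_identity: "unbounded_mono ennreal"
  using unbounded_mono_linear[of 1] by (simp add: divide_ennreal_def)

lemmas pieces_unbounded_mono =
  phi_unbounded_mono[OF z_in] phi_unbounded_mono[OF near_in] unbounded_mono_identity
  unbounded_mono_powr[of q, OF less_le_trans[OF zero_less_one q_ge_1]]
  unbounded_mono_linear[OF inv_slope_nonneg]

lemma approx_unbounded_mono: "unbounded_mono (approx k x)"
proof (cases "x \<in> \<Omega>")
  case True
  then have "approx k x = \<phi> x" by (simp add: approx_def fun_eq_iff)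
  then show ?thesis using phi_unbounded_mono True by simp
next
  case False
  show ?thesis
    unfolding approx_outside[OF False]
    by (intro unbounded_mono_max unbounded_mono_min pieces_unbounded_mono)
qed

lemma approx_growth: "power_growth C q (approx k x)"
proof (cases "x \<in> \<Omega>")
  case True
  then have "approx k x = \<phi> x" by (simp add: approx_def fun_eq_iff)
  then show ?thesis using phi_growth True by simp
next
  case False
  have "power_growth C q ennreal"
    using power_growth_linear[OF C_ge_1 q_ge_1, of 1] by (simp add: divide_ennreal_def)
  then show ?thesis
    unfolding approx_outside[OF False]
    by (intro power_growth_max power_growth_min phi_growth z_in near_in
        power_growth_powr power_growth_linear C_ge_1 q_ge_1)
qed

lemma inverse_approx_domain:
  assumes "x \<in> \<Omega>"
  shows "left_inverse (approx k) x \<sigma> = left_inverse \<phi> x \<sigma>"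
  using assms by (intro left_inverse_cong) (simp add: approx_def fun_eq_iff)

lemma inverse_approx_outside:
  assumes "x \<notin> \<Omega>" "0 < \<sigma>"
  shows "left_inverse (approx k) x \<sigma> =
    min (max (left_inverse \<phi> (z k) \<sigma>) \<sigma>)
      (max (max (left_inverse \<phi> (near k x) \<sigma>) (\<sigma> powr (1 / q))) (inv_slope k x * \<sigma>))"
proof -
  have "left_inverse (approx k) x \<sigma> = left_inverse (\<lambda>x t. max (min (\<phi> (z k) t) (ennreal t))
       (min (min (\<phi> (near k x) t) (ennreal (t powr q))) (ennreal t / ennreal (inv_slope k x)))) x \<sigma>"
    by (rule left_inverse_cong) (rule approx_outside[OF assms(1)])
  also have "\<dots> = min (left_inverse (\<lambda>x t. min (\<phi> (z k) t) (ennreal t)) x \<sigma>)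
      (left_inverse (\<lambda>x t. min (min (\<phi> (near k x) t) (ennreal (t powr q))) (ennreal t / ennreal (inv_slope k x))) x \<sigma>)"
    by (rule left_inverse_max) (intro unbounded_mono_min pieces_unbounded_mono)+
  also have "left_inverse (\<lambda>x t. min (\<phi> (z k) t) (ennreal t)) x \<sigma> =
      max (left_inverse (\<lambda>x t. \<phi> (z k) t) x \<sigma>) (left_inverse (\<lambda>x t. ennreal t) x \<sigma>)"
    by (rule left_inverse_min) (intro pieces_unbounded_mono)+
  also have "left_inverse (\<lambda>x t. min (min (\<phi> (near k x) t) (ennreal (t powr q))) (ennreal t / ennreal (inv_slope k x))) x \<sigma> =
      max (left_inverse (\<lambda>x t. min (\<phi> (near k x) t) (ennreal (t powr q))) x \<sigma>)
        (left_inverse (\<lambda>x t. ennreal t / ennreal (inv_slope k x)) x \<sigma>)"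
    by (rule left_inverse_min) (intro unbounded_mono_min pieces_unbounded_mono)+
  also have "left_inverse (\<lambda>x t. min (\<phi> (near k x) t) (ennreal (t powr q))) x \<sigma> =
      max (left_inverse (\<lambda>x t. \<phi> (near k x) t) x \<sigma>) (left_inverse (\<lambda>x t. ennreal (t powr q)) x \<sigma>)"
    by (rule left_inverse_min) (intro pieces_unbounded_mono)+
  also have "left_inverse (\<lambda>x t. \<phi> (z k) t) x \<sigma> = left_inverse \<phi> (z k) \<sigma>"
    by (rule left_inverse_cong) simp
  also have "left_inverse (\<lambda>x t. \<phi> (near k x) t) x \<sigma> = left_inverse \<phi> (near k x) \<sigma>"
    by (rule left_inverse_cong) simp
  also have "left_inverse (\<lambda>x t. ennreal t) x \<sigma> = \<sigma>"
    using left_inverse_linear[of "\<lambda>_. 1" x \<sigma>] assms by (simp add: divide_ennreal_def)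
  also have "left_inverse (\<lambda>x t. ennreal (t powr q)) x \<sigma> = \<sigma> powr (1 / q)"
    using left_inverse_powr[of q \<sigma>] assms q_ge_1 by simp
  also have "left_inverse (\<lambda>x t. ennreal t / ennreal (inv_slope k x)) x \<sigma> = inv_slope k x * \<sigma>"
    using left_inverse_linear[of "inv_slope k", OF inv_slope_nonneg assms(2)] .
  finally show ?thesis .
qed

lemma C2_ge_1: "1 \<le> C\<^sup>2"
  using C_ge_1 by (simp add: one_le_power)

lemma inverse_approx_nonneg: "0 \<le> left_inverse (approx k) x \<sigma>"
  using left_inverse_nonneg[of "approx k" x, OF approx_unbounded_mono] .

lemma inverse_approx_mono: "\<sigma> \<le> \<tau> \<Longrightarrow> left_inverse (approx k) x \<sigma> \<le> left_inverse (approx k) x \<tau>"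
  using left_inverse_mono[of "approx k" x, OF approx_unbounded_mono] .

lemma inverse_approx_le_linear:
  assumes "1 \<le> \<sigma>"
  shows "left_inverse (approx k) x \<sigma> \<le> C\<^sup>2 * \<sigma>"
proof (cases "x \<in> \<Omega>")
  case True
  then show ?thesis using inverse_le_linear assms by (simp add: inverse_approx_domain)
next
  case False
  have "left_inverse (approx k) x \<sigma> \<le> max (left_inverse \<phi> (z k) \<sigma>) \<sigma>"
    using assms by (subst inverse_approx_outside[OF False]) auto
  also have "\<dots> \<le> C\<^sup>2 * \<sigma>"
    using inverse_le_linear[OF z_in assms] C2_ge_1 mult_right_mono[of 1 "C\<^sup>2" \<sigma>] assms by simp
  finally show ?thesis .
qed

lemma inverse_approx_ge_1: "1 \<le> C * left_inverse (approx k) x 1"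
proof (cases "x \<in> \<Omega>")
  case True
  then show ?thesis using phi_inverse_1 by (simp add: inverse_approx_domain)
next
  case False
  have "1 \<le> left_inverse (approx k) x 1"
    by (subst inverse_approx_outside[OF False]) (auto simp: le_max_iff_disj)
  then show ?thesis using C_ge_1 mult_mono[of 1 C 1 "left_inverse (approx k) x 1"] by simp
qed

lemma extension_unbounded_mono: "unbounded_mono (extension x)"
proof -
  have "left_inverse (approx k) x \<sigma> \<le> C\<^sup>2 * max 1 \<sigma>" for k \<sigma>
    using inverse_approx_mono[of \<sigma> "max 1 \<sigma>" k x] inverse_approx_le_linear[of "max 1 \<sigma>" k x] by simp
  then have "\<exists>\<^sub>F k in sequentially. left_inverse (approx k) x \<sigma> \<le> C\<^sup>2 * max 1 \<sigma>" for \<sigma>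
    by (intro eventually_frequently) auto
  then have "unbounded_mono (\<lambda>t. limsup (\<lambda>k. approx k x t))"
    using unbounded_mono_limsup[of approx x, OF approx_unbounded_mono] by blast
  then show ?thesis by (simp add: extension_def[abs_def])
qed

lemma extension_eq: "extension = (\<lambda>x t. limsup (\<lambda>k. approx k x t))"
  by (simp add: extension_def fun_eq_iff)

lemma extension_domain: "x \<in> \<Omega> \<Longrightarrow> extension x t = \<phi> x t"
  by (simp add: extension_def approx_def Limsup_const)

lemma extension_growth: "power_growth C q (extension x)"
  unfolding extension_eq by (intro power_growth_limsup approx_growth)

lemma extension_zero: "extension x 0 = 0"
proof -
  have "approx k x 0 = 0" for k
    using phi_zero z_in near_in by (simp add: approx_def zero_ennreal_def[symmetric])
  then show ?thesis by (simp add: extension_def Limsup_const)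
qed

text \<open>
  For small \<open>t\<close> the pieces \<open>t\<close> and \<open>t powr q\<close> bound every \<open>approx k x t\<close> by \<open>t\<close> outside \<open>\<Omega>\<close>, uniformly in \<open>k\<close>.
\<close>

lemma extension_tendsto_0: "(extension x \<longlongrightarrow> 0) (at_right 0)"
proof (cases "x \<in> \<Omega>")
  case True
  then have "extension x = \<phi> x" by (simp add: extension_domain fun_eq_iff)
  then show ?thesis using phi_tendsto_0 True by simp
next
  case False
  have "extension x t \<le> ennreal t" if "0 < t" "t < 1" for t
  proof -
    have "t powr q \<le> t powr 1" using that q_ge_1 by (intro powr_mono') auto
    then have "ennreal (t powr q) \<le> ennreal t" using that by (intro ennreal_leI) simp
    then have "approx k x t \<le> ennreal t" for k
      using False by (auto simp: approx_def min.coboundedI1 min.coboundedI2)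
    then show ?thesis unfolding extension_def by (intro Limsup_bounded) auto
  qed
  then have "\<forall>\<^sub>F t in at_right 0. extension x t \<le> ennreal t"
    by (intro eventually_at_rightI[of 0 1]) auto
  moreover have "((\<lambda>t. ennreal t) \<longlongrightarrow> ennreal 0) (at_right 0)"
    by (intro tendsto_ennrealI tendsto_ident_at)
  ultimately show ?thesis
    using tendsto_sandwich[of "\<lambda>_. 0" "extension x" "at_right 0" ennreal 0] by simp
qed

lemma inverse_extension_le:
  assumes "\<exists>\<^sub>F k in sequentially. left_inverse (approx k) x \<sigma> \<le> b"
  shows "left_inverse extension x \<sigma> \<le> b"
  unfolding extension_eq using left_inverse_limsup_le[of approx, OF approx_unbounded_mono assms] .

lemma frequently_inverse_approx_le:
  assumes "0 < \<sigma>" "left_inverse extension x \<sigma> < s"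
  shows "\<exists>\<^sub>F k in sequentially. left_inverse (approx k) x \<sigma> \<le> 2 * C * s"
  using frequently_left_inverse_le[of approx x C q \<sigma> s] approx_unbounded_mono approx_growth C_ge_1
    extension_unbounded_mono[of x] assms by (simp add: extension_eq)

text \<open>
  Frequent smallness of the left-inverses at \<open>y\<close> follows from the value at \<open>y\<close>, is transported to \<open>x\<close>
  by the hypothesis, and there bounds the value of the extension.
\<close>

lemma inverse_extension_comparison:
  assumes "0 < D" "0 < \<sigma>"
    and "\<forall>\<^sub>F k in sequentially. left_inverse (approx k) x \<sigma> \<le> D * left_inverse (approx k) y \<sigma>"
  shows "left_inverse extension x \<sigma> \<le> 2 * C * D * left_inverse extension y \<sigma>"
proof (rule dense_ge)
  fix t assume t: "2 * C * D * left_inverse extension y \<sigma> < t"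
  have CD: "0 < 2 * C * D" using assms(1) C_ge_1 by simp
  have "left_inverse extension y \<sigma> < t / (2 * C * D)"
    using t CD by (simp add: field_simps)
  from frequently_inverse_approx_le[OF assms(2) this]
  have "\<exists>\<^sub>F k in sequentially. left_inverse (approx k) y \<sigma> \<le> t / D"
    using C_ge_1 by simp
  then have "\<exists>\<^sub>F k in sequentially. left_inverse (approx k) x \<sigma> \<le> t"
  proof (rule frequently_rev_mp)
    from assms(3) show "\<forall>\<^sub>F k in sequentially.
      left_inverse (approx k) y \<sigma> \<le> t / D \<longrightarrow> left_inverse (approx k) x \<sigma> \<le> t"
    proof eventually_elim
      case (elim k)
      show ?case
      proof
        assume "left_inverse (approx k) y \<sigma> \<le> t / D"
        then have "D * left_inverse (approx k) y \<sigma> \<le> D * (t / D)"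
          using assms(1) by (intro mult_left_mono) auto
        then show "left_inverse (approx k) x \<sigma> \<le> t" using elim assms(1) by simp
      qed
    qed
  qed
  then show "left_inverse extension x \<sigma> \<le> t" by (rule inverse_extension_le)
qed

lemma inverse_extension_nonneg: "0 \<le> left_inverse extension x \<sigma>"
  using left_inverse_nonneg[of extension x, OF extension_unbounded_mono] .

lemma inverse_extension_le_linear:
  assumes "1 \<le> \<sigma>"
  shows "left_inverse extension x \<sigma> \<le> C\<^sup>2 * \<sigma>"
  using inverse_approx_le_linear[OF assms]
  by (intro inverse_extension_le eventually_frequently) auto

lemma inverse_extension_ge_1: "1 \<le> 2 * C\<^sup>2 * left_inverse extension x 1"
proof (rule dense_le)
  show "t \<le> 2 * C\<^sup>2 * left_inverse extension x 1" if "t < 1" for t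
  proof (rule ccontr)
    assume "\<not> ?thesis"
    then have "left_inverse extension x 1 < t / (2 * C\<^sup>2)"
      using C_ge_1 by (simp add: field_simps)
    from frequently_inverse_approx_le[OF _ this]
    obtain k where "left_inverse (approx k) x 1 \<le> 2 * C * (t / (2 * C\<^sup>2))"
      using frequently_ex by force
    then have "left_inverse (approx k) x 1 * C \<le> t"
      using C_ge_1 by (simp add: field_simps power2_eq_square)
    then show False using inverse_approx_ge_1[of k x] that by (simp add: mult.commute)
  qed
qed

section \<open>The conditions for the extension\<close>

lemma extension_A0: "cond_A0 UNIV extension"
proof -
  define \<beta> where "\<beta> = inverse (2 * C\<^sup>2)"
  have "1 < 2 * C\<^sup>2" using C2_ge_1 by linarith
  then have "0 < \<beta>" "\<beta> < 1" unfolding \<beta>_def by (simp_all only: inverse_less_1_iff inverse_positive_iff_positive) auto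
  moreover have "\<beta> \<le> left_inverse extension x 1" for x
    using inverse_extension_ge_1[of x] C_ge_1 unfolding \<beta>_def by (simp add: field_simps)
  moreover have "left_inverse extension x 1 \<le> inverse \<beta>" for x
    using inverse_extension_le_linear[of 1 x] C2_ge_1
    unfolding \<beta>_def inverse_inverse_eq by simp
  ultimately show ?thesis unfolding cond_A0_def by force
qed

text \<open>
  At levels \<open>\<sigma> \<ge> 1\<close> only these two of the pieces of \<open>approx\<close> matter.
\<close>

definition profile :: "nat \<Rightarrow> real ^ 'n \<Rightarrow> real \<Rightarrow> real" where
  "profile k x \<sigma> = max (left_inverse \<phi> (near k x) \<sigma>) (inv_slope k x * \<sigma>)"

text \<open>
  The factor by which \<open>\<sigma>\<close> exceeds the start \<open>1 / inv_level x\<close> of the linear regime, and \<open>1\<close> if it does not.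
  Thus \<open>\<sigma> / excess x \<sigma>\<close> is the level \<open>\<sigma>\<close> capped at that start.
\<close>

definition excess :: "real ^ 'n \<Rightarrow> real \<Rightarrow> real" where
  "excess x \<sigma> = max 1 (inv_level x * \<sigma>)"

text \<open>
  The identity piece has left-inverse \<open>\<sigma>\<close>, which dominates all the others up to \<open>C\<^sup>2\<close> and so can be removed from the
  minimum; the power piece has left-inverse \<open>\<sigma> powr (1 / q)\<close>, which is dominated by the left-inverse of
  \<open>\<phi> (near k x)\<close> and so can be removed from the maximum.
\<close>

lemma inverse_approx_profile:
  assumes "1 \<le> \<sigma>"
  shows "left_inverse (approx k) x \<sigma> \<le> C\<^sup>2 * profile k x \<sigma>"
    and "profile k x \<sigma> \<le> C\<^sup>2 * left_inverse (approx k) x \<sigma>"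
proof -
  let ?N = "left_inverse \<phi> (near k x) \<sigma>"
  have N: "0 \<le> ?N" "?N \<le> C\<^sup>2 * \<sigma>" "\<sigma> powr (1 / q) \<le> C\<^sup>2 * ?N"
    using inverse_nonneg[OF near_in] inverse_le_linear[OF near_in assms] inverse_ge_root[OF near_in assms]
    by auto
  have P0: "0 \<le> profile k x \<sigma>" using N by (simp add: profile_def le_max_iff_disj)
  have sl: "inv_slope k x * \<sigma> \<le> C\<^sup>2 * \<sigma>"
  proof (cases "inv_level x = 0")
    case True
    then show ?thesis using assms by (simp add: inv_slope_def)
  next
    case False
    then have "0 < inv_level x" using inv_level_bounds[of x] by simp
    then have "inv_slope k x \<le> inv_level x * (C\<^sup>2 * (1 / inv_level x))"
      unfolding inv_slope_def using inv_level_bounds[of x]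
      by (intro mult_left_mono inverse_le_linear[OF near_in]) auto
    then show ?thesis using \<open>0 < inv_level x\<close> assms by (intro mult_right_mono) auto
  qed
  have "left_inverse (approx k) x \<sigma> \<le> C\<^sup>2 * profile k x \<sigma> \<and>
      profile k x \<sigma> \<le> C\<^sup>2 * left_inverse (approx k) x \<sigma>"
  proof (cases "x \<in> \<Omega>")
    case True
    then have "profile k x \<sigma> = left_inverse (approx k) x \<sigma>"
      using N by (simp add: profile_def inv_slope_def inv_level_domain inverse_approx_domain near_def)
    then show ?thesis using mult_right_mono[OF C2_ge_1 P0] by simp
  next
    case False
    have eq: "left_inverse (approx k) x \<sigma> = min (max (left_inverse \<phi> (z k) \<sigma>) \<sigma>)
        (max (max ?N (\<sigma> powr (1 / q))) (inv_slope k x * \<sigma>))"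
      using inverse_approx_outside[OF False] assms by simp
    have NP: "?N \<le> profile k x \<sigma>" "inv_slope k x * \<sigma> \<le> profile k x \<sigma>"
      by (auto simp: profile_def)
    have P1: "profile k x \<sigma> \<le> C\<^sup>2 * profile k x \<sigma>" using mult_right_mono[OF C2_ge_1 P0] by simp
    have "\<sigma> powr (1 / q) \<le> C\<^sup>2 * profile k x \<sigma>"
      using N(3) mult_left_mono[OF NP(1), of "C\<^sup>2"] by simp
    then have "max (max ?N (\<sigma> powr (1 / q))) (inv_slope k x * \<sigma>) \<le> C\<^sup>2 * profile k x \<sigma>"
      using NP P1 by simp
    then have upper: "left_inverse (approx k) x \<sigma> \<le> C\<^sup>2 * profile k x \<sigma>"
      unfolding eq by (simp add: min.coboundedI2)
    let ?a = "max (left_inverse \<phi> (z k) \<sigma>) \<sigma>" and ?b = "max (max ?N (\<sigma> powr (1 / q))) (inv_slope k x * \<sigma>)"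
    have "profile k x \<sigma> \<le> C\<^sup>2 * \<sigma>" using N(2) sl by (simp add: profile_def)
    also have "\<dots> \<le> C\<^sup>2 * ?a" by (intro mult_left_mono) auto
    finally have a: "profile k x \<sigma> \<le> C\<^sup>2 * ?a" .
    have "profile k x \<sigma> \<le> ?b" by (auto simp: profile_def)
    also have "?b \<le> C\<^sup>2 * ?b"
      using mult_right_mono[OF C2_ge_1, of ?b] N(1) by (simp add: le_max_iff_disj)
    finally have "profile k x \<sigma> \<le> C\<^sup>2 * ?b" .
    with a have "profile k x \<sigma> \<le> C\<^sup>2 * min ?a ?b" by (cases "?a \<le> ?b") (simp_all only: min_def if_True if_False)
    then show ?thesis using upper eq by simp
  qed
  then show "left_inverse (approx k) x \<sigma> \<le> C\<^sup>2 * profile k x \<sigma>"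
    and "profile k x \<sigma> \<le> C\<^sup>2 * left_inverse (approx k) x \<sigma>" by auto
qed

lemma excess_bounds:
  assumes "1 \<le> \<sigma>"
  shows "1 \<le> excess x \<sigma>" "1 \<le> \<sigma> / excess x \<sigma>" "\<sigma> / excess x \<sigma> \<le> \<sigma>"
proof -
  have "inv_level x * \<sigma> \<le> 1 * \<sigma>" using assms inv_level_bounds by (intro mult_right_mono) auto
  then have "excess x \<sigma> \<le> \<sigma>" using assms by (simp add: excess_def)
  moreover show 1: "1 \<le> excess x \<sigma>" by (simp add: excess_def)
  ultimately show "1 \<le> \<sigma> / excess x \<sigma>" by simp
  show "\<sigma> / excess x \<sigma> \<le> \<sigma>"
    using 1 assms mult_left_mono[of 1 "excess x \<sigma>" \<sigma>] by (simp add: divide_le_eq)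
qed

text \<open>
  The profile is the left-inverse of \<open>\<phi> (near k x)\<close> at the capped level, continued linearly.
\<close>

lemma profile_excess:
  assumes "1 \<le> \<sigma>"
  shows "profile k x \<sigma> \<le> C * excess x \<sigma> * left_inverse \<phi> (near k x) (\<sigma> / excess x \<sigma>)"
    and "excess x \<sigma> * left_inverse \<phi> (near k x) (\<sigma> / excess x \<sigma>) \<le> profile k x \<sigma>"
proof -
  define m where "m = excess x \<sigma>"
  have m: "1 \<le> m" "1 \<le> \<sigma> / m" "\<sigma> / m \<le> \<sigma>" "inv_level x * \<sigma> \<le> m"
    using excess_bounds[OF assms, of x] by (auto simp: m_def excess_def)
  let ?N = "left_inverse \<phi> (near k x)"
  have "?N \<sigma> \<le> C * (\<sigma> / (\<sigma> / m)) * ?N (\<sigma> / m)"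
    using m by (intro inverse_upper near_in) linarith+
  then have 1: "?N \<sigma> \<le> C * m * ?N (\<sigma> / m)" using assms m by simp
  have 2: "inv_slope k x * \<sigma> \<le> C * m * ?N (\<sigma> / m)"
  proof (cases "inv_level x = 0")
    case True
    then show ?thesis using C_ge_1 m inverse_nonneg[OF near_in] by (simp add: inv_slope_def)
  next
    case False
    then have w: "0 < inv_level x" using inv_level_bounds[of x] by simp
    have "?N (1 / inv_level x) \<le> C * (1 / inv_level x / (\<sigma> / m)) * ?N (\<sigma> / m)"
    proof (intro inverse_upper near_in)
      show "0 < \<sigma> / m" using m by linarith
      show "\<sigma> / m \<le> 1 / inv_level x" using w m assms by (simp add: divide_simps mult.commute)
    qed
    then have "inv_level x * \<sigma> * ?N (1 / inv_level x) \<le> inv_level x * \<sigma> * (C * (1 / inv_level x / (\<sigma> / m)) * ?N (\<sigma> / m))"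
      using w assms by (intro mult_left_mono) auto
    also have "\<dots> = C * m * ?N (\<sigma> / m)" using w assms m by simp
    finally show ?thesis by (simp add: inv_slope_def mult_ac)
  qed
  show "profile k x \<sigma> \<le> C * excess x \<sigma> * ?N (\<sigma> / excess x \<sigma>)"
    using 1 2 by (simp add: profile_def m_def)
  show "excess x \<sigma> * ?N (\<sigma> / excess x \<sigma>) \<le> profile k x \<sigma>"
  proof (cases "inv_level x * \<sigma> \<le> 1")
    case True
    then show ?thesis by (simp add: excess_def profile_def max_def)
  next
    case False
    then have "excess x \<sigma> = inv_level x * \<sigma>" "inv_level x \<noteq> 0" by (auto simp: excess_def)
    then show ?thesis using assms by (simp add: profile_def inv_slope_def mult_ac)
  qed
qed

text \<open>
  Comparability of \<open>approx k\<close> at \<open>x\<close> and \<open>y\<close> reduces to that of \<open>\<phi>\<close> at the two almost nearest points, at a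
  level capped for \<open>x\<close>, as soon as the caps for \<open>x\<close> and \<open>y\<close> agree up to a constant.
\<close>

lemma inverse_approx_comparison_near:
  assumes "1 \<le> \<sigma>" "1 \<le> B" "1 \<le> E" "excess x \<sigma> \<le> E * excess y \<sigma>" "excess y \<sigma> \<le> E * excess x \<sigma>"
    and "left_inverse \<phi> (near k x) (\<sigma> / excess x \<sigma>) \<le> B * left_inverse \<phi> (near k y) (\<sigma> / excess x \<sigma>)"
  shows "left_inverse (approx k) x \<sigma> \<le> C ^ 6 * B * E\<^sup>2 * left_inverse (approx k) y \<sigma>"
proof -
  define m n where "m = excess x \<sigma>" and "n = excess y \<sigma>"
  have m: "1 \<le> m" "1 \<le> \<sigma> / m" and n: "1 \<le> n" "1 \<le> \<sigma> / n"
    using excess_bounds[OF assms(1)] by (auto simp: m_def n_def)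
  have mn: "m \<le> E * n" "n \<le> E * m" using assms by (auto simp: m_def n_def)
  let ?Nx = "left_inverse \<phi> (near k x)" and ?Ny = "left_inverse \<phi> (near k y)"
  have nn: "0 \<le> ?Ny s" for s using inverse_nonneg[OF near_in] .
  have "\<sigma> / m \<le> E * (\<sigma> / n)" using mn m n assms(1)
    by (simp add: divide_simps mult.commute mult_left_mono)
  then have "?Ny (\<sigma> / m) \<le> ?Ny (E * (\<sigma> / n))" by (intro inverse_mono near_in)
  also have "\<dots> \<le> C * (E * (\<sigma> / n) / (\<sigma> / n)) * ?Ny (\<sigma> / n)"
    using n assms(3) mult_right_mono[of 1 E "\<sigma> / n"] by (intro inverse_upper near_in) linarith+
  also have "\<dots> = C * E * ?Ny (\<sigma> / n)" using n assms(1) by simp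
  finally have Ny: "?Ny (\<sigma> / m) \<le> C * E * ?Ny (\<sigma> / n)" .
  have "profile k x \<sigma> \<le> C * m * ?Nx (\<sigma> / m)"
    using profile_excess(1)[OF assms(1)] by (simp add: m_def)
  also have "\<dots> \<le> C * m * (B * ?Ny (\<sigma> / m))"
    using assms(6) C_ge_1 m by (intro mult_left_mono) (auto simp: m_def)
  also have "\<dots> \<le> C * (E * n) * (B * (C * E * ?Ny (\<sigma> / n)))"
  proof (rule mult_mono)
    show "C * m \<le> C * (E * n)" using mn C_ge_1 by simp
    show "B * ?Ny (\<sigma> / m) \<le> B * (C * E * ?Ny (\<sigma> / n))" using Ny assms(2) by simp
    show "0 \<le> C * (E * n)" "0 \<le> B * ?Ny (\<sigma> / m)" using C_ge_1 assms(2,3) n nn by auto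
  qed
  also have "\<dots> = C\<^sup>2 * B * E\<^sup>2 * (n * ?Ny (\<sigma> / n))" by (simp add: power2_eq_square mult_ac)
  also have "\<dots> \<le> C\<^sup>2 * B * E\<^sup>2 * profile k y \<sigma>"
    using profile_excess(2)[OF assms(1), of y k] assms(2) by (intro mult_left_mono) (auto simp: n_def)
  also have "\<dots> \<le> C\<^sup>2 * B * E\<^sup>2 * (C\<^sup>2 * left_inverse (approx k) y \<sigma>)"
    using inverse_approx_profile(2)[OF assms(1), of k y] assms(2) by (intro mult_left_mono) auto
  finally have "profile k x \<sigma> \<le> C\<^sup>2 * B * E\<^sup>2 * (C\<^sup>2 * left_inverse (approx k) y \<sigma>)" .
  then have "C\<^sup>2 * profile k x \<sigma> \<le> C\<^sup>2 * (C\<^sup>2 * B * E\<^sup>2 * (C\<^sup>2 * left_inverse (approx k) y \<sigma>))"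
    by (intro mult_left_mono) auto
  also have "\<dots> = C ^ 6 * B * E\<^sup>2 * left_inverse (approx k) y \<sigma>"
    by (simp add: eval_nat_numeral)
  finally show ?thesis using inverse_approx_profile(1)[OF assms(1), of k x] by linarith
qed

lemma inv_level_change:
  assumes "dist x y \<le> 2 * r" "0 \<le> r"
  shows "inv_level y \<le> 4 ^ CARD('n) * (inv_level x + r ^ CARD('n))"
proof -
  let ?n = "CARD('n)"
  have "infdist y \<Omega> \<le> infdist x \<Omega> + 2 * r"
    using infdist_triangle[of y \<Omega> x] assms by (simp add: dist_commute)
  then have "infdist y \<Omega> ^ ?n \<le> (infdist x \<Omega> + 2 * r) ^ ?n"
    by (intro power_mono infdist_nonneg)
  also have "\<dots> \<le> 2 ^ ?n * (infdist x \<Omega> ^ ?n + (2 * r) ^ ?n)"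
    using assms by (intro power_add_le infdist_nonneg) auto
  also have "\<dots> \<le> 2 ^ ?n * (2 ^ ?n * infdist x \<Omega> ^ ?n + 2 ^ ?n * r ^ ?n)"
    using mult_right_mono[of 1 "2 ^ ?n" "infdist x \<Omega> ^ ?n"] infdist_nonneg[of x \<Omega>]
    by (intro mult_left_mono add_mono) (auto simp: power_mult_distrib)
  also have "\<dots> = (2 ^ ?n * 2 ^ ?n) * (infdist x \<Omega> ^ ?n + r ^ ?n)"
    by (simp add: distrib_left mult.assoc)
  also have "(2::real) ^ ?n * 2 ^ ?n = 4 ^ ?n"
    by (subst power_mult_distrib[symmetric]) simp
  finally have *: "infdist y \<Omega> ^ ?n \<le> 4 ^ ?n * (infdist x \<Omega> ^ ?n + r ^ ?n)" .
  show ?thesis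
  proof (cases "infdist x \<Omega> ^ ?n \<le> 1")
    case True
    then show ?thesis using * by (simp add: inv_level_def)
  next
    case False
    then have "inv_level x = 1" by (simp add: inv_level_def)
    moreover have "1 * 1 \<le> (4::real) ^ ?n * (1 + r ^ ?n)" using assms by (intro mult_mono) auto
    ultimately show ?thesis using inv_level_bounds(2)[of y] by simp
  qed
qed

text \<open>
  The distance to \<open>\<Omega>\<close> changes by at most \<open>2 * r\<close>, and an admissible level satisfies \<open>\<sigma> * r ^ n \<le> b\<close>. Hence changes
  of the distance of order \<open>r\<close> do not affect the cap by more than a constant factor.
\<close>

lemma excess_change:
  assumes "dist x y \<le> 2 * r" "0 \<le> r" "0 \<le> \<sigma>" "\<sigma> * r ^ CARD('n) \<le> b"
  shows "excess y \<sigma> \<le> 4 ^ CARD('n) * (1 + b) * excess x \<sigma>"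
proof -
  let ?D = "4 ^ CARD('n) :: real"
  have "0 \<le> \<sigma> * r ^ CARD('n)" using assms by simp
  then have b: "0 \<le> b" using assms(4) by (rule order_trans)
  have D: "1 \<le> ?D" by simp
  have m: "1 \<le> excess x \<sigma>" "inv_level x * \<sigma> \<le> excess x \<sigma>" by (auto simp: excess_def)
  have "inv_level y * \<sigma> \<le> ?D * (inv_level x + r ^ CARD('n)) * \<sigma>"
    using inv_level_change[OF assms(1,2)] assms(3) by (rule mult_right_mono)
  also have "\<dots> = ?D * (inv_level x * \<sigma> + \<sigma> * r ^ CARD('n))" by (simp add: algebra_simps)
  also have "\<dots> \<le> ?D * (excess x \<sigma> + b * excess x \<sigma>)"
    using m assms(4) mult_left_mono[OF m(1) b] by (intro mult_left_mono add_mono) auto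
  also have "\<dots> = ?D * (1 + b) * excess x \<sigma>" by (simp add: algebra_simps)
  finally have "inv_level y * \<sigma> \<le> ?D * (1 + b) * excess x \<sigma>" .
  moreover have "1 * 1 \<le> ?D * (1 + b) * excess x \<sigma>"
    using m b mult_mono[OF D, of 1 "1 + b"] by (intro mult_mono) auto
  ultimately show ?thesis by (simp add: excess_def)
qed

text \<open>
  The two almost nearest points are at distance of order \<open>r + d\<close>, where \<open>d\<close> is the distance of \<open>x\<close> to \<open>\<Omega>\<close>. The
  capped level is at most \<open>\<sigma>\<close>, which controls \<open>r\<close>, and at most \<open>1 / d ^ n\<close> if \<open>d \<le> 1\<close>, which controls \<open>d\<close>. If
  \<open>d > 1\<close>, the capped level is \<open>1\<close>. This is the situation of \<open>A1_enlarged\<close>.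
\<close>

lemma near_points_close:
  assumes "dist x y \<le> 2 * r" "inverse (real (Suc k)) \<le> r" "1 \<le> \<sigma>" "\<sigma> * r ^ CARD('n) \<le> b"
    and "2 ^ CARD('n) * (6 ^ CARD('n) * b + 2 ^ CARD('n)) \<le> A"
  shows "\<sigma> / excess x \<sigma> \<le> A \<or> \<sigma> / excess x \<sigma> * dist (near k x) (near k y) ^ CARD('n) \<le> A"
proof -
  let ?n = "CARD('n)" and ?d = "infdist x \<Omega>"
  have "0 < inverse (real (Suc k))" by simp
  then have r: "0 < r" using assms(2) by (rule less_le_trans)
  have "0 \<le> \<sigma> * r ^ ?n" using r assms(3) by simp
  then have b: "0 \<le> b" using assms(4) by (rule order_trans)
  have A: "1 \<le> A"
  proof -
    have "1 * 1 \<le> (2::real) ^ ?n * (6 ^ ?n * b + 2 ^ ?n)"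
      using b by (intro mult_mono) (auto intro: add_increasing)
    then show ?thesis using assms(5) by simp
  qed
  show ?thesis
  proof (cases "?d \<le> 1")
    case False
    then have "inv_level x = 1" by (simp add: inv_level_def one_le_power)
    then have "excess x \<sigma> = \<sigma>" using assms(3) by (simp add: excess_def)
    then show ?thesis using A assms(3) by simp
  next
    case True
    then have w: "inv_level x = ?d ^ ?n" by (simp add: inv_level_def power_le_one infdist_nonneg)
    define \<tau> where "\<tau> = \<sigma> / excess x \<sigma>"
    have \<tau>: "0 \<le> \<tau>" "\<tau> \<le> \<sigma>" "\<tau> * inv_level x \<le> 1"
      using excess_bounds[OF assms(3), of x] assms(3) by (auto simp: \<tau>_def excess_def divide_simps mult.commute)
    have "dist (near k x) (near k y) \<le> dist x (near k x) + dist x y + dist y (near k y)"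
      using dist_triangle[of "near k x" "near k y" x] dist_triangle[of x "near k y" y]
      by (simp add: dist_commute)
    also have "\<dots> \<le> (?d + r) + 2 * r + (?d + 2 * r + r)"
      \<comment> \<open>The distance of \<open>y\<close> to \<open>\<Omega>\<close> is bounded by that of \<open>x\<close> plus \<open>2 * r\<close>.\<close>
      using dist_near[of x k] dist_near[of y k] infdist_triangle[of y \<Omega> x] assms(1,2)
      by (simp add: dist_commute)
    finally have "dist (near k x) (near k y) \<le> 6 * r + 2 * ?d" by simp
    then have "dist (near k x) (near k y) ^ ?n \<le> (6 * r + 2 * ?d) ^ ?n"
      by (intro power_mono) auto
    also have "\<dots> \<le> 2 ^ ?n * ((6 * r) ^ ?n + (2 * ?d) ^ ?n)"
      using r by (intro power_add_le) (auto simp: infdist_nonneg)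
    finally have "\<tau> * dist (near k x) (near k y) ^ ?n \<le> \<tau> * (2 ^ ?n * ((6 * r) ^ ?n + (2 * ?d) ^ ?n))"
      using \<tau> by (intro mult_left_mono) auto
    also have "\<dots> = 2 ^ ?n * (6 ^ ?n * (\<tau> * r ^ ?n) + 2 ^ ?n * (\<tau> * inv_level x))"
      by (simp add: power_mult_distrib w algebra_simps)
    also have "\<dots> \<le> 2 ^ ?n * (6 ^ ?n * b + 2 ^ ?n * 1)"
    proof -
      have "\<tau> * r ^ ?n \<le> \<sigma> * r ^ ?n" using \<tau> r by (intro mult_right_mono) auto
      then show ?thesis using \<tau> assms(4) by (intro mult_left_mono add_mono) auto
    qed
    finally show ?thesis using assms(5) by (simp add: \<tau>_def)
  qed
qed

lemma extension_A1:
  assumes "cond_A1 \<Omega> \<phi>"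
  shows "cond_A1 UNIV extension"
proof -
  let ?n = "CARD('n)"
  define V where "V = unit_ball_vol (real ?n)"
  have V: "0 < V" by (simp add: V_def)
  define b where "b = 1 / V"
  define A where "A = 2 ^ ?n * (6 ^ ?n * b + 2 ^ ?n)"
  have b: "0 \<le> b" using V by (simp add: b_def)
  have "1 * 1 \<le> A"
    unfolding A_def using b by (intro mult_mono) (auto intro: add_increasing)
  then obtain B where B: "1 \<le> B" and close:
    "\<And>u v \<sigma>. u \<in> \<Omega> \<Longrightarrow> v \<in> \<Omega> \<Longrightarrow> 1 \<le> \<sigma> \<Longrightarrow> \<sigma> \<le> A \<or> \<sigma> * dist u v ^ ?n \<le> A \<Longrightarrow>
      left_inverse \<phi> u \<sigma> \<le> B * left_inverse \<phi> v \<sigma>"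
    using A1_enlarged[OF assms, of A] by (auto simp: mult.commute)
  define E where "E = 4 ^ ?n * (1 + b)"
  have "1 * 1 \<le> E" unfolding E_def using b by (intro mult_mono) auto
  then have E: "1 \<le> E" by simp
  define D where "D = C ^ 6 * B * E\<^sup>2"
  have "1 * 1 * 1 \<le> D" unfolding D_def using B E C_ge_1 by (intro mult_mono one_le_power) auto
  then have D: "1 \<le> D" by simp
  define \<beta> where "\<beta> = inverse (2 * C * D)"
  have CD: "1 < 2 * C * D" using mult_mono[of 1 C 1 D] C_ge_1 D by simp
  then have \<beta>: "0 < \<beta>" "\<beta> < 1"
    unfolding \<beta>_def by (simp_all only: inverse_less_1_iff inverse_positive_iff_positive) auto
  have "\<beta> * left_inverse extension x \<sigma> \<le> left_inverse extension y \<sigma>"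
    if r: "0 < r" and x: "x \<in> ball c r" and y: "y \<in> ball c r"
      and \<sigma>: "1 \<le> \<sigma>" "\<sigma> \<le> 1 / measure lebesgue (ball c r)" for c x y r \<sigma>
  proof -
    have vol: "measure lebesgue (ball c r) = V * r ^ ?n"
      using measure_lebesgue_ball[of r c] r by (simp add: V_def)
    have \<sigma>r: "\<sigma> * r ^ ?n \<le> b"
      using \<sigma>(2) V r unfolding vol b_def by (simp add: field_simps)
    have xy: "dist x y \<le> 2 * r"
      using x y dist_triangle[of x y c] by (simp add: dist_commute)
    have "(\<lambda>k. inverse (real (Suc k))) \<longlonglongrightarrow> 0" by (rule LIMSEQ_inverse_real_of_nat)
    then have "\<forall>\<^sub>F k in sequentially. inverse (real (Suc k)) < r"
      using r by (intro order_tendstoD(2)) auto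
    then have "\<forall>\<^sub>F k in sequentially.
      left_inverse (approx k) x \<sigma> \<le> D * left_inverse (approx k) y \<sigma>"
    proof eventually_elim
      case (elim k)
      show ?case
        unfolding D_def
      proof (rule inverse_approx_comparison_near[OF \<sigma>(1) B E])
        show "excess x \<sigma> \<le> E * excess y \<sigma>" "excess y \<sigma> \<le> E * excess x \<sigma>"
          unfolding E_def using xy r \<sigma> \<sigma>r by (auto intro!: excess_change simp: dist_commute)
        show "left_inverse \<phi> (near k x) (\<sigma> / excess x \<sigma>)
            \<le> B * left_inverse \<phi> (near k y) (\<sigma> / excess x \<sigma>)"
          using elim xy \<sigma> \<sigma>r
          by (intro close near_in excess_bounds near_points_close[where b = b and r = r]) (auto simp: A_def)
      qed
    qed
    then have "left_inverse extension x \<sigma> \<le> 2 * C * D * left_inverse extension y \<sigma>"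
      using D \<sigma> by (intro inverse_extension_comparison) auto
    then show ?thesis using CD by (simp add: \<beta>_def field_simps)
  qed
  then show ?thesis
    unfolding cond_A1_def using \<beta> by (intro bexI[of _ \<beta>]) auto
qed

text \<open>
  At levels at most \<open>1\<close> the power piece makes the second argument of \<open>min\<close> in \<open>inverse_approx_outside\<close>
  at least \<open>\<sigma> powr (1 / q)\<close>, which dominates the left-inverse of \<open>\<phi> (z k)\<close>, whereas the identity piece is dominated by it.
\<close>

lemma inverse_approx_limit_outside:
  assumes "x \<notin> \<Omega>" "0 < \<sigma>" "\<sigma> \<le> 1"
  shows "left_inverse (approx k) x \<sigma> \<le> C\<^sup>2 * left_inverse \<phi> (z k) \<sigma>"
    and "left_inverse \<phi> (z k) \<sigma> \<le> C\<^sup>2 * left_inverse (approx k) x \<sigma>"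
proof -
  let ?N = "left_inverse \<phi> (z k) \<sigma>"
  let ?b = "max (max (left_inverse \<phi> (near k x) \<sigma>) (\<sigma> powr (1 / q))) (inv_slope k x * \<sigma>)"
  note eq = inverse_approx_outside[OF assms(1,2), of k]
  have N: "0 \<le> ?N" "\<sigma> \<le> C\<^sup>2 * ?N" "?N \<le> C\<^sup>2 * \<sigma> powr (1 / q)"
    using inverse_nonneg[OF z_in] inverse_ge_linear[OF z_in] inverse_le_root[OF z_in] assms by auto
  have N1: "?N \<le> C\<^sup>2 * ?N" using mult_right_mono[OF C2_ge_1 N(1)] by simp
  show "left_inverse (approx k) x \<sigma> \<le> C\<^sup>2 * ?N"
    unfolding eq using N(2) N1 by (intro min.coboundedI1) simp
  have "?N \<le> C\<^sup>2 * max ?N \<sigma>"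
    using N1 mult_left_mono[of ?N "max ?N \<sigma>" "C\<^sup>2"] by simp
  moreover have "?N \<le> C\<^sup>2 * ?b"
  proof -
    have "\<sigma> powr (1 / q) \<le> ?b" by (simp add: le_max_iff_disj)
    then have "C\<^sup>2 * \<sigma> powr (1 / q) \<le> C\<^sup>2 * ?b" by (intro mult_left_mono) auto
    with N(3) show ?thesis by linarith
  qed
  ultimately show "?N \<le> C\<^sup>2 * left_inverse (approx k) x \<sigma>"
    unfolding eq by (cases "max ?N \<sigma> \<le> ?b") (simp_all only: min_def if_True if_False)
qed

text \<open>
  With \<open>h\<close> extended by zero, both points are compared with \<open>\<phi> (z k)\<close> at levels up to \<open>1\<close>; at levels between
  \<open>1\<close> and \<open>s\<close> the extension has left-inverses between constants that depend on \<open>s\<close>.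
\<close>

lemma extension_A2:
  assumes B: "1 \<le> B" and h: "\<And>x. 0 \<le> h x"
    and int: "integrable (lebesgue_on \<Omega>) h" and bdd: "AE x in lebesgue_on \<Omega>. \<bar>h x\<bar> \<le> c"
    and limit: "limit_sequence B h z"
  shows "cond_A2 UNIV extension"
  unfolding cond_A2_def
proof (intro allI impI)
  fix s :: real assume s: "0 < s"
  define H where "H x = indicator \<Omega> x *\<^sub>R h x" for x
  have meas: "\<Omega> \<in> sets lebesgue" using open_domain by simp
  have H: "0 \<le> H x" "x \<in> \<Omega> \<Longrightarrow> H x = h x" for x using h by (auto simp: H_def)
  have H_int: "integrable (lebesgue_on UNIV) H"
    using int meas by (simp add: integrable_restrict_space lebesgue_on_UNIV_eq H_def[abs_def])
  have H_bdd: "AE x in lebesgue_on UNIV. \<bar>H x\<bar> \<le> max 0 c"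
  proof -
    have "AE x in lebesgue. x \<in> \<Omega> \<longrightarrow> \<bar>h x\<bar> \<le> c"
      using bdd meas by (simp add: AE_restrict_space_iff)
    then show ?thesis
      unfolding lebesgue_on_UNIV_eq by eventually_elim (auto simp: H_def indicator_def)
  qed
  define E where "E = B * C\<^sup>2"
  have "1 * 1 \<le> E" unfolding E_def using B C2_ge_1 by (intro mult_mono) auto
  then have E: "1 \<le> E" "B \<le> E" "C\<^sup>2 \<le> E"
    unfolding E_def using B C2_ge_1 mult_left_mono[of 1 "C\<^sup>2" B] mult_right_mono[of 1 B "C\<^sup>2"] by auto
  have limit': "\<forall>\<^sub>F k in sequentially. left_inverse (approx k) x \<sigma> \<le> E * left_inverse \<phi> (z k) \<sigma> \<and>
      left_inverse \<phi> (z k) \<sigma> \<le> E * left_inverse (approx k) x \<sigma>"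
    if \<sigma>: "0 < \<sigma>" "\<sigma> \<le> 1" "H x \<le> \<sigma>" for x \<sigma>
  proof -
    have up: "left_inverse (approx k) x \<sigma> \<le> E * left_inverse \<phi> (z k) \<sigma> \<and>
      left_inverse \<phi> (z k) \<sigma> \<le> E * left_inverse (approx k) x \<sigma>"
      if "left_inverse (approx k) x \<sigma> \<le> D * left_inverse \<phi> (z k) \<sigma> \<and>
      left_inverse \<phi> (z k) \<sigma> \<le> D * left_inverse (approx k) x \<sigma>" "D \<le> E" for D k
      using that(1) mult_right_mono[OF that(2) inverse_approx_nonneg[of k x \<sigma>]]
        mult_right_mono[OF that(2) inverse_nonneg[OF z_in, of k \<sigma>]] by linarith
    show ?thesis
    proof (cases "x \<in> \<Omega>")
      case True
      then have "h x \<le> \<sigma>" using H(2) \<sigma>(3) by simp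
      with limit True \<sigma>(1,2) have "\<forall>\<^sub>F k in sequentially.
          left_inverse \<phi> x \<sigma> \<le> B * left_inverse \<phi> (z k) \<sigma> \<and> left_inverse \<phi> (z k) \<sigma> \<le> B * left_inverse \<phi> x \<sigma>"
        unfolding limit_sequence_def by blast
      then show ?thesis
        by eventually_elim (rule up[OF _ E(2)], simp add: inverse_approx_domain[OF True])
    next
      case False
      then show ?thesis
        using inverse_approx_limit_outside[OF False \<sigma>(1,2)] by (intro always_eventually allI up[OF _ E(3)]) auto
    qed
  qed
  define D where "D = 2 * C * E\<^sup>2 + 2 * C ^ 4 * max 1 s"
  have D: "1 \<le> D" "2 * C * E\<^sup>2 \<le> D" "2 * C ^ 4 * max 1 s \<le> D"
  proof -
    have "1 * 1 \<le> C * E\<^sup>2" using C_ge_1 E by (intro mult_mono one_le_power) auto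
    moreover have "0 \<le> C ^ 4 * max 1 s" using C_ge_1 by simp
    ultimately show "1 \<le> D" "2 * C * E\<^sup>2 \<le> D" "2 * C ^ 4 * max 1 s \<le> D"
      unfolding D_def mult.assoc by linarith+
  qed
  have main: "left_inverse extension x \<sigma> \<le> D * left_inverse extension y \<sigma>"
    if "H x + H y \<le> \<sigma>" "\<sigma> \<le> s" for x y \<sigma>
  proof -
    consider "\<sigma> \<le> 0" | "0 < \<sigma>" "\<sigma> \<le> 1" | "1 \<le> \<sigma>" by linarith
    then show ?thesis
    proof cases
      case 1
      then show ?thesis by (simp add: left_inverse_nonpos_eq)
    next
      case 2
      have "H x \<le> \<sigma>" "H y \<le> \<sigma>" using that(1) H(1)[of x] H(1)[of y] by linarith+
      from limit'[OF 2 this(1)] limit'[OF 2 this(2)]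
      have "\<forall>\<^sub>F k in sequentially. left_inverse (approx k) x \<sigma> \<le> E\<^sup>2 * left_inverse (approx k) y \<sigma>"
      proof eventually_elim
        case (elim k)
        have "left_inverse (approx k) x \<sigma> \<le> E * left_inverse \<phi> (z k) \<sigma>" using elim by simp
        also have "\<dots> \<le> E * (E * left_inverse (approx k) y \<sigma>)"
          using elim E by (intro mult_left_mono) auto
        finally show ?case by (simp add: power2_eq_square mult.assoc)
      qed
      then have "left_inverse extension x \<sigma> \<le> 2 * C * E\<^sup>2 * left_inverse extension y \<sigma>"
        using E 2 by (intro inverse_extension_comparison) auto
      also have "\<dots> \<le> D * left_inverse extension y \<sigma>"
        using D by (intro mult_right_mono inverse_extension_nonneg) auto
      finally show ?thesis .
    next
      case 3
      have "1 \<le> 2 * C\<^sup>2 * left_inverse extension y 1" by (rule inverse_extension_ge_1)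
      also have "\<dots> \<le> 2 * C\<^sup>2 * left_inverse extension y \<sigma>"
        using left_inverse_mono[of extension y, OF extension_unbounded_mono 3] by (intro mult_left_mono) auto
      finally have y: "1 \<le> 2 * C\<^sup>2 * left_inverse extension y \<sigma>" .
      have "left_inverse extension x \<sigma> \<le> C\<^sup>2 * \<sigma>" by (rule inverse_extension_le_linear[OF 3])
      also have "\<dots> \<le> C\<^sup>2 * max 1 s * 1" using that by (simp add: mult_left_mono)
      also have "\<dots> \<le> C\<^sup>2 * max 1 s * (2 * C\<^sup>2 * left_inverse extension y \<sigma>)"
        using y by (intro mult_left_mono) auto
      also have "\<dots> = 2 * C ^ 4 * max 1 s * left_inverse extension y \<sigma>"
        by (simp add: eval_nat_numeral)
      also have "\<dots> \<le> D * left_inverse extension y \<sigma>"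
        using D by (intro mult_right_mono inverse_extension_nonneg) auto
      finally show ?thesis .
    qed
  qed
  show "\<exists>\<beta>\<in>{0<..1}. \<exists>h. integrable (lebesgue_on UNIV) h \<and> (\<exists>C. AE x in lebesgue_on UNIV. \<bar>h x\<bar> \<le> C) \<and>
      (\<forall>x\<in>UNIV. \<forall>y\<in>UNIV. \<forall>t\<in>{h x + h y..s}. \<beta> * left_inverse extension x t \<le> left_inverse extension y t)"
  proof (intro bexI[of _ "inverse D"] exI[of _ H] conjI exI[of _ "max 0 c"] ballI H_int H_bdd)
    show "inverse D \<in> {0<..1}" using D by (simp add: inverse_le_1_iff)
    fix x y t assume "t \<in> {H x + H y..s}"
    then show "inverse D * left_inverse extension x t \<le> left_inverse extension y t"
      using main[of x y t] D by (simp add: field_simps)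
  qed
qed

text \<open>
  Outside \<open>\<Omega>\<close> the functions \<open>approx k\<close> involve \<open>\<phi>\<close> only at points of a countable set, where monotonicity in \<open>t\<close>
  gives measurability. On \<open>\<Omega>\<close> the hypothesis on \<open>\<phi>\<close> applies.
\<close>

lemma extension_measurable:
  assumes f: "f \<in> borel_measurable (lebesgue_on UNIV)"
  shows "(\<lambda>x. extension x \<bar>f x\<bar>) \<in> borel_measurable (lebesgue_on UNIV)"
proof -
  have dom: "\<Omega> \<in> sets lebesgue" using open_domain by simp
  have [measurable]: "f \<in> borel_measurable lebesgue" using f by (simp add: lebesgue_on_UNIV_eq)
  have [measurable]: "(\<lambda>x. infdist x \<Omega>) \<in> borel_measurable lebesgue"
    by (intro measurable_completion) (simp add: borel_measurable_continuous_onI continuous_on_infdist)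
  have [measurable]: "(\<lambda>x. dist x a) \<in> borel_measurable lebesgue" for a :: "real ^ 'n"
    by (intro measurable_completion) (simp add: borel_measurable_continuous_onI continuous_on_dist)
  have [measurable]: "near_index k \<in> measurable lebesgue (count_space UNIV)" for k
    unfolding near_index_def[abs_def] by measurable
  have [measurable]: "inv_level \<in> borel_measurable lebesgue"
    unfolding inv_level_def[abs_def] by measurable
  have "mono (left_inverse \<phi> u)" if "u \<in> \<Omega>" for u
    using inverse_mono[OF that] by (intro monoI)
  then have [measurable]: "left_inverse \<phi> (e i) \<in> borel_measurable borel" for i
    using e_in by (intro borel_measurable_mono) auto
  have phi_abs: "(\<lambda>t. \<phi> u \<bar>t\<bar>) \<in> borel_measurable borel" if "u \<in> \<Omega>" for u
    using unbounded_mono_comp_abs_measurable[OF phi_unbounded_mono[OF that]] .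
  have phi_f: "(\<lambda>x. \<phi> u \<bar>f x\<bar>) \<in> borel_measurable lebesgue" if "u \<in> \<Omega>" for u
    using measurable_compose[OF _ phi_abs[OF that], of f lebesgue] by simp
  define g where "g k x = max (min (\<phi> (z k) \<bar>f x\<bar>) (ennreal \<bar>f x\<bar>))
       (min (min (\<phi> (e (near_index k x)) \<bar>f x\<bar>) (ennreal (\<bar>f x\<bar> powr q)))
         (ennreal \<bar>f x\<bar> / ennreal (inv_level x * left_inverse \<phi> (e (near_index k x)) (1 / inv_level x))))" for k x
  have [measurable]: "(\<lambda>x. \<phi> (z k) \<bar>f x\<bar>) \<in> borel_measurable lebesgue" for k
    by (rule phi_f[OF z_in])
  have [measurable]: "(\<lambda>x. \<phi> (e (near_index k x)) \<bar>f x\<bar>) \<in> borel_measurable lebesgue" for k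
    by (rule measurable_compose_countable[of "\<lambda>i x. \<phi> (e i) \<bar>f x\<bar>", OF phi_f[OF e_in]]) measurable
  have [measurable]: "(\<lambda>x. left_inverse \<phi> (e (near_index k x)) (1 / inv_level x)) \<in> borel_measurable lebesgue" for k
    by (rule measurable_compose_countable[of "\<lambda>i x. left_inverse \<phi> (e i) (1 / inv_level x)"]) measurable
  have [measurable]: "g k \<in> borel_measurable lebesgue" for k
    unfolding g_def[abs_def] by measurable
  have "(\<lambda>x. \<phi> x \<bar>f x\<bar>) \<in> borel_measurable (lebesgue_on \<Omega>)"
    by (intro phi_measurable measurable_restrict_space1) measurable
  then have [measurable]: "(\<lambda>x. \<phi> x \<bar>f x\<bar> * indicator \<Omega> x) \<in> borel_measurable lebesgue"
    using dom by (subst (asm) borel_measurable_restrict_space_iff_ennreal) auto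
  have "extension x \<bar>f x\<bar> = (if x \<in> \<Omega> then \<phi> x \<bar>f x\<bar> * indicator \<Omega> x else limsup (\<lambda>k. g k x))" for x
    by (auto simp: extension_domain) (auto simp: extension_def approx_def g_def near_def inv_slope_def)
  moreover have "(\<lambda>x. if x \<in> \<Omega> then \<phi> x \<bar>f x\<bar> * indicator \<Omega> x else limsup (\<lambda>k. g k x))
      \<in> borel_measurable lebesgue"
    using dom by (intro measurable_If) (auto simp: Collect_mem_eq)
  ultimately show ?thesis by (simp add: lebesgue_on_UNIV_eq)
qed

lemma extension_weak_Phi: "weak_Phi UNIV extension"
  unfolding weak_Phi_def
proof (intro conjI ballI allI impI)
  fix x
  show "mono_on {0..} (extension x)"
    using extension_unbounded_mono by (simp add: unbounded_mono_def)
  show "extension x 0 = 0" by (rule extension_zero)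
  show "(extension x \<longlongrightarrow> 0) (at_right 0)" by (rule extension_tendsto_0)
  show "(extension x \<longlongrightarrow> \<infinity>) at_top"
    by (intro unbounded_mono_tendsto_top extension_unbounded_mono)
next
  show "\<exists>L\<ge>1. \<forall>x\<in>UNIV. almost_increasing_on L {0<..} (\<lambda>t. extension x t / ennreal t)"
    using extension_growth C_ge_1 power_growth_iff[OF C_ge_1] by blast
qed (rule extension_measurable)

lemma extension_aDec: "cond_aDec q UNIV extension"
  unfolding cond_aDec_def using extension_growth C_ge_1 power_growth_iff[OF C_ge_1] by blast

end

section \<open>The extension theorem\<close>

text \<open>
  Every function extends one on the empty domain, where the construction has no points to start from.
\<close>

lemma linear_Phi:
  assumes "1 \<le> q"
  defines "\<psi> \<equiv> \<lambda>x :: real ^ 'n. ennreal"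
  shows "weak_Phi UNIV \<psi>" "cond_A0 UNIV \<psi>" "cond_A1 UNIV \<psi>" "cond_A2 UNIV \<psi>" "cond_aDec q UNIV \<psi>"
proof -
  have um: "unbounded_mono ennreal"
    using unbounded_mono_linear[of 1] by (simp add: divide_ennreal_def)
  have gr: "power_growth 1 q ennreal"
    using power_growth_linear[of 1 q 1] assms by (simp add: divide_ennreal_def)
  have inv: "left_inverse \<psi> x \<sigma> = max 0 \<sigma>" for x \<sigma>
  proof (cases "0 < \<sigma>")
    case True
    then show ?thesis
      using left_inverse_linear[of "\<lambda>_. 1" x \<sigma>] by (simp add: divide_ennreal_def \<psi>_def)
  qed (simp add: left_inverse_nonpos_eq)
  have "((\<lambda>t. ennreal t) \<longlongrightarrow> ennreal 0) (at_right 0)"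
    by (intro tendsto_ennrealI tendsto_ident_at)
  then show "weak_Phi UNIV \<psi>"
    unfolding weak_Phi_def \<psi>_def
    using um unbounded_mono_tendsto_top[OF um] power_growth_iff[of 1 q ennreal] gr
    by (auto simp: unbounded_mono_def intro!: exI[of _ 1])
  show "cond_A0 UNIV \<psi>" unfolding cond_A0_def inv by (intro bexI[of _ "1 / 2"]) auto
  show "cond_A1 UNIV \<psi>" unfolding cond_A1_def inv by (intro bexI[of _ "1 / 2"]) auto
  show "cond_A2 UNIV \<psi>" unfolding cond_A2_def inv
    by (intro allI impI bexI[of _ 1] exI[of _ "\<lambda>_. 0"]) auto
  show "cond_aDec q UNIV \<psi>"
    unfolding cond_aDec_def \<psi>_def using power_growth_iff[of 1 q ennreal] gr by (auto intro!: exI[of _ 1])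
qed

theorem corollary3p10:
  fixes \<Omega> :: "(real ^ 'n) set" and \<phi> :: "real ^ 'n \<Rightarrow> real \<Rightarrow> ennreal"
    and K \<delta> q :: real
  assumes "open \<Omega>"
    and "K \<ge> 1" and "\<delta> > 0" and "quasi_convex K \<delta> \<Omega>"
    and "weak_Phi \<Omega> \<phi>"
    and "cond_A0 \<Omega> \<phi>" and "cond_A1 \<Omega> \<phi>" and "cond_A2 \<Omega> \<phi>"
    and "q \<ge> 1" and "cond_aDec q \<Omega> \<phi>"
  shows "\<exists>\<psi> :: real ^ 'n \<Rightarrow> real \<Rightarrow> ennreal.
           weak_Phi UNIV \<psi> \<and> extends_from \<psi> \<Omega> \<phi> \<and>
           cond_A0 UNIV \<psi> \<and> cond_A1 UNIV \<psi> \<and> cond_A2 UNIV \<psi> \<and> cond_aDec q UNIV \<psi>"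
proof (cases "\<Omega> = {}")
  case True
  then have "extends_from \<psi> \<Omega> \<phi>" for \<psi> by (simp add: extends_from_def)
  then show ?thesis using linear_Phi[OF \<open>q \<ge> 1\<close>] by blast
next
  case False
  have weak: "\<And>u. u \<in> \<Omega> \<Longrightarrow> mono_on {0..} (\<phi> u) \<and> \<phi> u 0 = 0 \<and>
      (\<phi> u \<longlongrightarrow> 0) (at_right 0) \<and> (\<phi> u \<longlongrightarrow> \<infinity>) at_top"
    and meas: "\<And>f :: real ^ 'n \<Rightarrow> real. f \<in> borel_measurable (lebesgue_on \<Omega>) \<Longrightarrow>
      (\<lambda>x. \<phi> x \<bar>f x\<bar>) \<in> borel_measurable (lebesgue_on \<Omega>)"
    using \<open>weak_Phi \<Omega> \<phi>\<close> unfolding weak_Phi_def by blast+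
  obtain L\<^sub>1 where L\<^sub>1: "1 \<le> L\<^sub>1" "\<And>u. u \<in> \<Omega> \<Longrightarrow> almost_increasing_on L\<^sub>1 {0<..} (\<lambda>t. \<phi> u t / ennreal t)"
    using \<open>weak_Phi \<Omega> \<phi>\<close> unfolding weak_Phi_def by blast
  obtain L\<^sub>q where L\<^sub>q: "1 \<le> L\<^sub>q" "\<And>u. u \<in> \<Omega> \<Longrightarrow> almost_decreasing_on L\<^sub>q {0<..} (\<lambda>t. \<phi> u t / ennreal (t powr q))"
    using \<open>cond_aDec q \<Omega> \<phi>\<close> unfolding cond_aDec_def by blast
  obtain \<beta> where \<beta>: "0 < \<beta>" "\<beta> < 1"
    "\<And>u. u \<in> \<Omega> \<Longrightarrow> \<beta> \<le> left_inverse \<phi> u 1 \<and> left_inverse \<phi> u 1 \<le> inverse \<beta>"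
    using \<open>cond_A0 \<Omega> \<phi>\<close> unfolding cond_A0_def by auto
  define C where "C = max (inverse \<beta>) (max L\<^sub>1 L\<^sub>q)"
  have C: "1 \<le> C" "L\<^sub>1 \<le> C" "L\<^sub>q \<le> C" "inverse \<beta> \<le> C" using L\<^sub>1(1) by (auto simp: C_def)
  interpret controlled_Phi \<Omega> \<phi> q C
  proof
    fix u assume u: "u \<in> \<Omega>"
    show "unbounded_mono (\<phi> u)" using weak[OF u] by (intro unbounded_monoI_tendsto) auto
    show "\<phi> u 0 = 0" using weak[OF u] by simp
    show "power_growth C q (\<phi> u)"
      unfolding power_growth_iff[OF C(1)]
      using almost_increasing_on_mono[OF L\<^sub>1(2)[OF u] C(2)] almost_decreasing_on_mono[OF L\<^sub>q(2)[OF u] C(3)] by blast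
    have "1 \<le> inverse \<beta> * left_inverse \<phi> u 1" using \<beta>(1) \<beta>(3)[OF u] by (simp add: field_simps)
    also have "\<dots> \<le> C * left_inverse \<phi> u 1"
      using C(4) \<beta>(1) \<beta>(3)[OF u] by (intro mult_right_mono) auto
    finally show "1 \<le> C * left_inverse \<phi> u 1 \<and> left_inverse \<phi> u 1 \<le> C"
      using order_trans[OF conjunct2[OF \<beta>(3)[OF u]] C(4)] by (rule conjI)
  qed (fact \<open>open \<Omega>\<close> \<open>q \<ge> 1\<close> C(1))+
  obtain B h z where B: "1 \<le> B" and h: "\<forall>x. 0 \<le> h x" "integrable (lebesgue_on \<Omega>) h"
    "\<exists>c. AE x in lebesgue_on \<Omega>. \<bar>h x\<bar> \<le> c" and z: "range z \<subseteq> \<Omega>" and limit: "limit_sequence B h z"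
    using A2_limit_sequence[OF \<open>cond_A2 \<Omega> \<phi>\<close> False] .
  obtain c where c: "AE x in lebesgue_on \<Omega>. \<bar>h x\<bar> \<le> c" using h(3) by blast
  obtain T where T: "countable T" "T \<subseteq> \<Omega>" "\<Omega> \<subseteq> closure T" by (rule separable)
  with False have "T \<noteq> {}" by auto
  with T have e: "range (from_nat_into T) = T" by (simp add: range_from_nat_into)
  interpret Phi_extension \<Omega> \<phi> q C "from_nat_into T" z
    by unfold_locales (use T e z weak meas in auto)
  have "extends_from extension \<Omega> \<phi>"
    by (simp add: extends_from_def extension_domain)
  then show ?thesis
    using extension_weak_Phi extension_A0 extension_A1[OF \<open>cond_A1 \<Omega> \<phi>\<close>] extension_A2[OF B _ h(2) c limit] h(1)
      extension_aDec by blast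
qed
end
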